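(* Let $q=p^s$ be a power of a prime $p$, $n\ge1$, $k=\bar{\mathbb{F}}_p$, $G_n=GL_n(\mathbb{F}_q)$, and $e_n=\det(x_i^{q^{j-1}})_{1\le i,j\le n}\in k[x_1,\dots,x_n]$. Let $A'=k[x_1,\dots,x_n]/(e_n^{q-1}-1)$ and $Q'=\mathrm{Spec}(A')$, with the $G_n$-action induced by the usual linear action on $x_1,\dots,x_n$. Then $$(A')^{G_n}\cong k[c_{n,1},\dots,c_{n,n-1}],$$ a polynomial algebra on (the images of) the Dickson invariants $c_{n,1},\dots,c_{n,n-1}$; that is, $Q'/G_n\cong\mathbb{A}^{n-1}$.
   Context: The Dickson invariants $c_{n,i}\in\mathbb{F}_q[x_1,\dots,x_n]$ are defined by $\sum_{i=0}^{n}c_{n,i}X^{q^i}=\prod_{(\lambda_1,\dots,\lambda_n)\in\mathbb{F}_q^n}(X+\lambda_1x_1+\cdots+\lambda_nx_n)$ (so $c_{n,n}=1$); they satisfy $\mathbb{F}_q[x_1,\dots,x_n]^{G_n}=\mathbb{F}_q[c_{n,0},\dots,c_{n,n-1}]$. *)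

theory Defs
  imports
    "HOL-Analysis.Analysis"
    "HOL-Library.Poly_Mapping"
    "HOL-Algebra.QuotRing"
    "HOL-Algebra.Algebraic_Closure_Type"
    "Jordan_Normal_Form.Determinant"
    "Berlekamp_Zassenhaus.Finite_Field"
begin

section \<open>Polynomial rings in finitely many variables\<close>

text \<open>A polynomial is a finitely supported map from exponent vectors to coefficients.  Variables
  are numbered from 0, so what is usually written $x_1, \dots, x_n$ is
  \<open>Var 0, \<dots>, Var (n - 1)\<close>.\<close>

type_synonym 'k mpol = "(nat \<Rightarrow>\<^sub>0 nat) \<Rightarrow>\<^sub>0 'k"

definition Var :: "nat \<Rightarrow> 'k::comm_ring_1 mpol" where
  "Var i = Poly_Mapping.single (Poly_Mapping.single i 1) 1"

definition Const :: "'k::comm_ring_1 \<Rightarrow> 'k mpol" where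
  "Const c = Poly_Mapping.single 0 c"

definition poly_subst :: "(nat \<Rightarrow> 'k mpol) \<Rightarrow> 'k::comm_ring_1 mpol \<Rightarrow> 'k mpol" where
  "poly_subst h f = (\<Sum>m\<in>Poly_Mapping.keys f. Const (Poly_Mapping.lookup f m) *
      (\<Prod>i\<in>Poly_Mapping.keys m. h i ^ Poly_Mapping.lookup m i))"

definition mpoly_ring :: "nat \<Rightarrow> 'k::comm_ring_1 mpol ring" where
  "mpoly_ring n =
    \<lparr>carrier = {f. \<forall>m\<in>Poly_Mapping.keys f. Poly_Mapping.keys m \<subseteq> {..<n}},
     mult = (*), one = 1, zero = 0, add = (+)\<rparr>"

section \<open>Algebras over a field and affine schemes\<close>

text \<open>A \<open>'k\<close>-algebra is given by a ring together with its structure map from \<open>'k\<close>.\<close>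

definition algebra_iso ::
  "('r, 'x) ring_scheme \<Rightarrow> ('k \<Rightarrow> 'r) \<Rightarrow> ('t, 'y) ring_scheme \<Rightarrow> ('k \<Rightarrow> 't) \<Rightarrow> ('r \<Rightarrow> 't) set" where
  "algebra_iso R \<iota> S \<kappa> = {h \<in> ring_iso R S. \<forall>c. h (\<iota> c) = \<kappa> c}"

definition zariski_topology :: "('r, 'x) ring_scheme \<Rightarrow> 'r set topology" where
  "zariski_topology R =
    topology_generated_by ((\<lambda>a. {P. primeideal P R \<and> a \<notin> P}) ` carrier R)"

text \<open>The fraction $a/s$ in the localisation $R_P$, as an equivalence class of pairs.\<close>

definition frac_at :: "('r, 'x) ring_scheme \<Rightarrow> 'r set \<Rightarrow> 'r \<Rightarrow> 'r \<Rightarrow> ('r \<times> 'r) set" where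
  "frac_at R P a s =
    {(b, t). b \<in> carrier R \<and> t \<in> carrier R - P \<and>
      (\<exists>u\<in>carrier R - P. u \<otimes>\<^bsub>R\<^esub> (a \<otimes>\<^bsub>R\<^esub> t \<ominus>\<^bsub>R\<^esub> b \<otimes>\<^bsub>R\<^esub> s) = \<zero>\<^bsub>R\<^esub>)}"

text \<open>In the sum and the product the unions range over all representatives; they are unions of
  equal sets.\<close>

definition localization_at :: "('r, 'x) ring_scheme \<Rightarrow> 'r set \<Rightarrow> ('r \<times> 'r) set ring" where
  "localization_at R P =
    \<lparr>carrier = {frac_at R P a s | a s. a \<in> carrier R \<and> s \<in> carrier R - P},
     mult = (\<lambda>C D. \<Union>(a, s)\<in>C. \<Union>(b, t)\<in>D. frac_at R P (a \<otimes>\<^bsub>R\<^esub> b) (s \<otimes>\<^bsub>R\<^esub> t)),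
     one = frac_at R P \<one>\<^bsub>R\<^esub> \<one>\<^bsub>R\<^esub>,
     zero = frac_at R P \<zero>\<^bsub>R\<^esub> \<one>\<^bsub>R\<^esub>,
     add = (\<lambda>C D. \<Union>(a, s)\<in>C. \<Union>(b, t)\<in>D.
       frac_at R P (a \<otimes>\<^bsub>R\<^esub> t \<oplus>\<^bsub>R\<^esub> b \<otimes>\<^bsub>R\<^esub> s) (s \<otimes>\<^bsub>R\<^esub> t))\<rparr>"

text \<open>Sections over \<open>U\<close> are the families of elements of the local rings at the points of \<open>U\<close> that
  are locally given by a single fraction.\<close>

definition structure_sheaf ::
  "('r, 'x) ring_scheme \<Rightarrow> 'r set set \<Rightarrow> ('r set \<Rightarrow> ('r \<times> 'r) set) ring" where
  "structure_sheaf R U =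
    \<lparr>carrier = {\<sigma> \<in> (\<Pi>\<^sub>E P\<in>U. carrier (localization_at R P)).
       \<forall>P\<in>U. \<exists>V. openin (zariski_topology R) V \<and> P \<in> V \<and> V \<subseteq> U \<and>
         (\<exists>a\<in>carrier R. \<exists>s\<in>carrier R. \<forall>Q\<in>V. s \<notin> Q \<and> \<sigma> Q = frac_at R Q a s)},
     mult = (\<lambda>\<sigma> \<tau>. \<lambda>P\<in>U. \<sigma> P \<otimes>\<^bsub>localization_at R P\<^esub> \<tau> P),
     one = (\<lambda>P\<in>U. \<one>\<^bsub>localization_at R P\<^esub>),
     zero = (\<lambda>P\<in>U. \<zero>\<^bsub>localization_at R P\<^esub>),
     add = (\<lambda>\<sigma> \<tau>. \<lambda>P\<in>U. \<sigma> P \<oplus>\<^bsub>localization_at R P\<^esub> \<tau> P)\<rparr>"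

text \<open>A space with a sheaf of \<open>'k\<close>-algebras: the rings of sections, the restriction maps from the
  first to the second open set, and the structure maps from \<open>'k\<close>.\<close>

record ('p, 's, 'k) ringed_space =
  points :: "'p topology"
  sections :: "'p set \<Rightarrow> 's ring"
  restriction :: "'p set \<Rightarrow> 'p set \<Rightarrow> 's \<Rightarrow> 's"
  scalar :: "'p set \<Rightarrow> 'k \<Rightarrow> 's"

definition Spec ::
  "('r, 'x) ring_scheme \<Rightarrow> ('k \<Rightarrow> 'r) \<Rightarrow> ('r set, 'r set \<Rightarrow> ('r \<times> 'r) set, 'k) ringed_space" where
  "Spec R \<iota> =
    \<lparr>points = zariski_topology R,
     sections = structure_sheaf R,
     restriction = (\<lambda>U V \<sigma>. restrict \<sigma> V),
     scalar = (\<lambda>U c. \<lambda>P\<in>U. frac_at R P (\<iota> c) \<one>\<^bsub>R\<^esub>)\<rparr>"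

text \<open>Isomorphism over \<open>'k\<close>: a homeomorphism and a compatible isomorphism of sheaves of
  \<open>'k\<close>-algebras.  An isomorphism of rings is automatically local, so for affine schemes this is
  isomorphism of schemes over \<open>'k\<close>.\<close>

definition isomorphic_over ::
  "('p, 's, 'k) ringed_space \<Rightarrow> ('q, 't, 'k) ringed_space \<Rightarrow> bool" where
  "isomorphic_over S T \<longleftrightarrow>
    (\<exists>f \<theta>. homeomorphic_map (points S) (points T) f \<and>
      (let pre = (\<lambda>V. {x \<in> topspace (points S). f x \<in> V}) in
        (\<forall>V. openin (points T) V \<longrightarrow>
          \<theta> V \<in> algebra_iso (sections T V) (scalar T V) (sections S (pre V)) (scalar S (pre V))) \<and>
        (\<forall>V W. openin (points T) V \<and> openin (points T) W \<and> W \<subseteq> V \<longrightarrow>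
          (\<forall>\<sigma>\<in>carrier (sections T V).
            \<theta> W (restriction T V W \<sigma>) = restriction S (pre V) (pre W) (\<theta> V \<sigma>)))))"

definition affine_space ::
  "nat \<Rightarrow> ('k::comm_ring_1 mpol set, 'k mpol set \<Rightarrow> ('k mpol \<times> 'k mpol) set, 'k) ringed_space" where
  "affine_space m = Spec (mpoly_ring m) Const"

text \<open>For a group \<open>G\<close> acting through \<open>act\<close> on the ring \<open>R\<close>: the ring of invariants $R^G$, and
  the quotient of $\mathrm{Spec}\, R$ by a finite group, which is $\mathrm{Spec}(R^G)$.\<close>

definition invariants :: "'r ring \<Rightarrow> 'g set \<Rightarrow> ('g \<Rightarrow> 'r \<Rightarrow> 'r) \<Rightarrow> 'r ring" where
  "invariants R G act = R\<lparr>carrier := {a \<in> carrier R. \<forall>g\<in>G. act g a = a}\<rparr>"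

definition Spec_quotient ::
  "'r ring \<Rightarrow> ('k \<Rightarrow> 'r) \<Rightarrow> 'g set \<Rightarrow> ('g \<Rightarrow> 'r \<Rightarrow> 'r) \<Rightarrow>
    ('r set, 'r set \<Rightarrow> ('r \<times> 'r) set, 'k) ringed_space" where
  "Spec_quotient R \<iota> G act = Spec (invariants R G act) \<iota>"

section \<open>The general linear group and the Dickson invariants\<close>

text \<open>The subfield $\mathbb{F}_q$ of the algebraic closure of $\mathbb{F}_p$, for \<open>q\<close> a power of
  \<open>p\<close>: the fixed points of the \<open>q\<close>-th power map.\<close>

definition Fq :: "nat \<Rightarrow> 'k::field set" where
  "Fq q = {a. a ^ q = a}"

lemma card_Fq:
  assumes "s \<ge> 1"
  shows "card (Fq (CARD('p) ^ s) :: 'p::prime_card mod_ring alg_closure set) = CARD('p) ^ s"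
proof -
  let ?q = "CARD('p) ^ s"
  define f :: "'p mod_ring alg_closure poly" where "f = Polynomial.monom 1 ?q - [:0, 1:]"
  have p1: "CARD('p) > 1" using prime_card[where 'a='p] prime_gt_1_nat by blast
  have q1: "?q > 1" using p1 assms by (intro one_less_power) auto
  have deg: "Polynomial.degree f = ?q"
  proof -
    have "Polynomial.degree (- [:0, 1 :: 'p mod_ring alg_closure:]) < Polynomial.degree (Polynomial.monom (1 :: 'p mod_ring alg_closure) ?q)"
      using q1 by (simp add: degree_monom_eq)
    from degree_add_eq_left[OF this] show ?thesis unfolding f_def diff_conv_add_uminus by (simp only: degree_monom_eq one_neq_zero not_False_eq_True)
  qed
  have f0: "f \<noteq> 0" using deg q1 by auto
  have "(of_nat ?q :: 'p mod_ring alg_closure) = 0"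
    using assms by (simp only: of_nat_eq_0_iff_char_dvd) simp
  hence pd: "pderiv f = [:-1:]"
    by (simp add: f_def pderiv_diff pderiv_monom pderiv_pCons power_0_left)
  obtain A where A: "size A = Polynomial.degree f" "f = Polynomial.smult (Polynomial.coeff f (Polynomial.degree f)) (\<Prod>x\<in>#A. [:-x, 1:])"
    using alg_closed_imp_factorization[OF f0] by blast
  have roots: "Fq ?q = {x. poly f x = 0}"
    by (auto simp: Fq_def f_def poly_monom)
  have "poly f x = 0 \<longleftrightarrow> x \<in># A" for x
  proof -
    have "poly f x = Polynomial.coeff f (Polynomial.degree f) * (\<Prod>y\<in>#A. x - y)"
      by (subst A(2)) (simp add: poly_prod_mset image_mset.compositionality o_def)
    thus ?thesis using f0 by (auto simp: prod_mset_zero_iff)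
  qed
  hence Fq: "Fq ?q = set_mset A" using roots by auto
  have "count A x \<le> 1" for x
  proof (rule ccontr)
    assume "\<not> count A x \<le> 1"
    hence "{#x, x#} \<subseteq># A" by (auto simp: subseteq_mset_def)
    then obtain B where "A = {#x, x#} + B" by (metis subset_mset.le_iff_add)
    hence "f = [:-x, 1:] * ([:-x, 1:] * Polynomial.smult (Polynomial.coeff f (Polynomial.degree f)) (\<Prod>x\<in>#B. [:-x, 1:]))"
      using A(2) by (simp add: algebra_simps)
    then obtain g where g: "f = [:-x, 1:] * ([:-x, 1:] * g)" by blast
    have "poly (pderiv f) x = 0" by (subst g, simp only: pderiv_mult) simp
    thus False using pd by simp
  qed
  hence "A = mset_set (set_mset A)"
    by (intro multiset_eqI) (metis (mono_tags, lifting) count_eq_zero_iff count_mset_set(1,3)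
      finite_set_mset le_antisym less_one not_le)
  hence "size A = card (set_mset A)" by (metis size_mset_set)
  thus ?thesis using A(1) deg Fq by simp
qed

definition GL :: "nat \<Rightarrow> nat \<Rightarrow> 'k::field mat set" where
  "GL q n = {g \<in> carrier_mat n n. elements_mat g \<subseteq> Fq q \<and>
    (\<exists>h\<in>carrier_mat n n. elements_mat h \<subseteq> Fq q \<and> g * h = 1\<^sub>m n \<and> h * g = 1\<^sub>m n)}"

text \<open>The left action on polynomials with \<open>g\<close> acting on the span of the variables through its
  columns: $g \cdot x_i = \sum_j g_{ji} x_j$.\<close>

definition GL_act :: "nat \<Rightarrow> 'k::field mat \<Rightarrow> 'k mpol \<Rightarrow> 'k mpol" where
  "GL_act n g = poly_subst (\<lambda>i. \<Sum>j<n. Const (g $$ (j, i)) * Var j)"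

text \<open>The product runs over all vectors $v \in \mathbb{F}_q^n$.  It is a polynomial in a further
  variable $X$ in which only the powers $X^{q^i}$ with $i \le n$ occur, and the Dickson invariants
  are its coefficients.\<close>

definition dickson_poly :: "nat \<Rightarrow> nat \<Rightarrow> 'k::field mpol poly" where
  "dickson_poly q n = (\<Prod>v\<in>{..<n} \<rightarrow>\<^sub>E Fq q. [:\<Sum>i<n. Const (v i) * Var i, 1:])"

definition dickson :: "nat \<Rightarrow> nat \<Rightarrow> nat \<Rightarrow> 'k::field mpol" where
  "dickson q n i = poly.coeff (dickson_poly q n) (q ^ i)"

definition moore_det :: "nat \<Rightarrow> nat \<Rightarrow> 'k::field mpol" where
  "moore_det q n = det (mat n n (\<lambda>(i, j). Var i ^ (q ^ j)))"

definition A'_ideal :: "nat \<Rightarrow> nat \<Rightarrow> 'k::field mpol set" where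
  "A'_ideal q n = Idl\<^bsub>mpoly_ring n\<^esub> {moore_det q n ^ (q - 1) - 1}"

definition A' :: "nat \<Rightarrow> nat \<Rightarrow> 'k::field mpol set ring" where
  "A' q n = mpoly_ring n Quot A'_ideal q n"

definition A'_class :: "nat \<Rightarrow> nat \<Rightarrow> 'k::field mpol \<Rightarrow> 'k mpol set" where
  "A'_class q n f = A'_ideal q n +>\<^bsub>mpoly_ring n\<^esub> f"

definition A'_const :: "nat \<Rightarrow> nat \<Rightarrow> 'k::field \<Rightarrow> 'k mpol set" where
  "A'_const q n c = A'_class q n (Const c)"

text \<open>Since $e_n^{q-1}$ is invariant, the group preserves the ideal $I$ and the image of the
  coset $I + f$ under $g$ is the coset $I + g \cdot f$.\<close>

definition A'_act :: "nat \<Rightarrow> 'k::field mat \<Rightarrow> 'k mpol set \<Rightarrow> 'k mpol set" where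
  "A'_act n g C = GL_act n g ` C"

definition A'_invariants :: "nat \<Rightarrow> nat \<Rightarrow> 'k::field mpol set ring" where
  "A'_invariants q n = invariants (A' q n) (GL q n) (A'_act n)"

end

theory Submission
  imports Defs
begin

text \<open>Modulo $e_n^{q-1} - 1$ (called \<open>rel n\<close>) every nonzero
  $\mathbb{F}_q$-linear form becomes a unit, because the product of all of them is
  $c_{n,0} = (-1)^n e_n^{q-1}$.

  Invariants are polynomials in the Dickson invariants: adjoin $x_1, \dots, x_n$ to
  $k[c_{n,0}, \dots, c_{n,n-1}]$ one at a time.  As $x_{m+1}$ is a root of the monic polynomial
  $\prod (X + w)$ over the forms $w$ outside the span of $x_1, \dots, x_m$, every element $h$ of the
  next ring is a polynomial in $x_{m+1}$ of degree less than $q^n - q^m$ over the previous one.  If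
  $h$ is invariant modulo \<open>rel n\<close>, then this polynomial takes the value $h$ at all $q^n - q^m$ forms
  outside the span, whose differences are units, so $h$ is congruent to its constant coefficient.

  The remaining Dickson invariants are independent: for prescribed values of
  $c_{n,1}, \dots, c_{n,n-1}$ and $c_{n,0} = (-1)^n$ the additive polynomial with these coefficients
  is separable, and an $\mathbb{F}_q$-basis of its root space in $k$ is a point of $Q'$ where these
  values are attained.\<close>

section \<open>Evaluation of polynomials\<close>

text \<open>For n >= 2 the order of the group is divisible by p, so averaging cannot lift an
  invariant of the quotient to an invariant polynomial. The descent therefore works directly with
  the congruences \<open>rel n dvd GL_act n g h - h\<close>; that the Dickson invariants generate
  all invariant polynomials is not presupposed. The descent closes because two numbers coincide: q^n
  - q^m is both the degree bound and the number of sample points. Since \<open>rel n\<close> need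
  not be prime, the usual count of roots is replaced by one that only asks for cancellable
  differences.

  The formula for c_{n,0} comes from bordering the Moore matrix with a row X, X^q, ..., X^(q^n). The
  determinant is e_n times the product of all X + w, and the minor at X is e_n^q up to sign; one
  factor e_n cancels.

  All computations use divisibility by \<open>rel n\<close> among polynomials; cosets appear only at
  the end. The statement on schemes then follows formally from the isomorphism of algebras.\<close>

lemma poly_mapping_induct_add [case_names zero single add]:
  fixes f :: "'a \<Rightarrow>\<^sub>0 'b::comm_monoid_add"
  assumes "P 0" "\<And>m c. P (Poly_Mapping.single m c)" "\<And>f g. P f \<Longrightarrow> P g \<Longrightarrow> P (f + g)"
  shows "P f"
proof (induction f rule: Poly_Mapping.update_induct)
  case const then show ?case by (rule assms(1))
next
  case (update f a b)
  have "Poly_Mapping.update a b f = f + Poly_Mapping.single a b"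
    using update(1) by (intro poly_mapping_eqI)
      (auto simp: lookup_update lookup_add lookup_single when_def in_keys_iff)
  then show ?case using assms(2,3) update by simp
qed

definition mexp :: "(nat \<Rightarrow> 'r::comm_ring_1) \<Rightarrow> (nat \<Rightarrow>\<^sub>0 nat) \<Rightarrow> 'r" where
  "mexp h m = (\<Prod>i\<in>Poly_Mapping.keys m. h i ^ Poly_Mapping.lookup m i)"

lemma mexp_superset:
  assumes "finite A" "Poly_Mapping.keys m \<subseteq> A"
  shows "mexp h m = (\<Prod>i\<in>A. h i ^ Poly_Mapping.lookup m i)"
  unfolding mexp_def by (rule prod.mono_neutral_left) (use assms in \<open>auto simp: in_keys_iff\<close>)

lemma mexp_add: "mexp h (m + m') = mexp h m * mexp h m'"
proof -
  let ?A = "Poly_Mapping.keys m \<union> Poly_Mapping.keys m'"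
  have "mexp h (m + m') = (\<Prod>i\<in>?A. h i ^ Poly_Mapping.lookup (m + m') i)"
    using keys_add[of m m'] by (intro mexp_superset) auto
  also have "\<dots> = (\<Prod>i\<in>?A. h i ^ Poly_Mapping.lookup m i) * (\<Prod>i\<in>?A. h i ^ Poly_Mapping.lookup m' i)"
    by (simp add: lookup_add power_add prod.distrib)
  also have "\<dots> = mexp h m * mexp h m'"
    by (simp add: mexp_superset[of ?A])
  finally show ?thesis .
qed

lemma mexp_zero [simp]: "mexp h 0 = 1"
  by (simp add: mexp_def)

lemma mexp_single [simp]: "mexp h (Poly_Mapping.single i k) = h i ^ k"
  by (cases "k = 0") (simp_all add: mexp_def)

text \<open>Coefficients pass through \<open>\<phi>\<close> into any commutative ring, so that
  substitution (with \<open>Const\<close>) and evaluation at a point of k^n (with the identity)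
  share one set of lemmas.\<close>

definition peval :: "('k::comm_ring_1 \<Rightarrow> 'r::comm_ring_1) \<Rightarrow> (nat \<Rightarrow> 'r) \<Rightarrow> 'k mpol \<Rightarrow> 'r" where
  "peval \<phi> h f = (\<Sum>m\<in>Poly_Mapping.keys f. \<phi> (Poly_Mapping.lookup f m) * mexp h m)"

lemma poly_subst_eq_peval: "poly_subst = peval Const"
  by (simp add: fun_eq_iff poly_subst_def peval_def mexp_def)

lemma Const_comm_ring_hom: "comm_ring_hom (Const :: 'k::comm_ring_1 \<Rightarrow> 'k mpol)"
  by unfold_locales (simp_all add: Const_def single_add mult_single)

lemma inj_Const: "inj Const"
  by (metis Const_def injI lookup_single_eq)

context
  fixes \<phi> :: "'k::comm_ring_1 \<Rightarrow> 'r::comm_ring_1" and h :: "nat \<Rightarrow> 'r"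
  assumes hom: "comm_ring_hom \<phi>"
begin

interpretation comm_ring_hom \<phi> by (rule hom)

lemma peval_superset:
  assumes "finite A" "Poly_Mapping.keys f \<subseteq> A"
  shows "peval \<phi> h f = (\<Sum>m\<in>A. \<phi> (Poly_Mapping.lookup f m) * mexp h m)"
  unfolding peval_def by (rule sum.mono_neutral_left) (use assms in \<open>auto simp: in_keys_iff\<close>)

lemma peval_zero: "peval \<phi> h 0 = 0"
  by (simp add: peval_def)

lemma peval_single: "peval \<phi> h (Poly_Mapping.single m c) = \<phi> c * mexp h m"
  by (cases "c = 0") (simp_all add: peval_def)

lemma peval_add: "peval \<phi> h (f + g) = peval \<phi> h f + peval \<phi> h g"
proof -
  let ?A = "Poly_Mapping.keys f \<union> Poly_Mapping.keys g"
  show ?thesis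
    using keys_add[of f g]
    by (simp add: peval_superset[of ?A] lookup_add hom_add algebra_simps sum.distrib)
qed

lemma peval_mult: "peval \<phi> h (f * g) = peval \<phi> h f * peval \<phi> h g"
proof (induction f rule: poly_mapping_induct_add)
  case (single m c)
  show ?case
    by (induction g rule: poly_mapping_induct_add)
      (simp_all add: peval_zero peval_single peval_add mult_single hom_mult mexp_add algebra_simps)
qed (simp_all add: peval_zero peval_add algebra_simps)

lemma peval_Const: "peval \<phi> h (Const c) = \<phi> c"
  by (simp add: Const_def peval_single)

lemma peval_Var: "peval \<phi> h (Var i) = h i"
  by (simp add: Var_def peval_single)

lemma peval_comm_ring_hom: "comm_ring_hom (peval \<phi> h)"
  by unfold_locales
    (simp_all add: peval_zero peval_add peval_mult peval_single flip: single_one)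

end

lemma mexp_Var: "mexp Var m = Poly_Mapping.single m (1::'k::comm_ring_1)"
proof (induction m rule: poly_mapping_induct_add)
  case zero
  then show ?case by simp
next
  case (single i k)
  have "Var i ^ k = (Poly_Mapping.single (Poly_Mapping.single i k) 1 :: 'k mpol)"
    by (induction k) (simp_all add: Var_def mult_single flip: single_add)
  then show ?case by simp
next
  case (add f g)
  then show ?case by (simp add: mexp_add mult_single)
qed

lemma peval_Const_Var: "peval Const Var f = f"
proof (induction f rule: poly_mapping_induct_add)
  case (single m c)
  then show ?case
    by (simp add: peval_single[OF Const_comm_ring_hom] mexp_Var) (simp add: Const_def mult_single)
qed (simp_all add: peval_zero peval_add Const_comm_ring_hom)

section \<open>Subrings and subalgebras generated by a set of polynomials\<close>

definition is_subring :: "'a::comm_ring_1 set \<Rightarrow> bool" where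
  "is_subring T \<longleftrightarrow> 1 \<in> T \<and> (\<forall>a\<in>T. - a \<in> T) \<and> (\<forall>a\<in>T. \<forall>b\<in>T. a + b \<in> T \<and> a * b \<in> T)"

lemma is_subringD:
  assumes "is_subring T"
  shows "1 \<in> T" "0 \<in> T" "a \<in> T \<Longrightarrow> - a \<in> T" "a \<in> T \<Longrightarrow> b \<in> T \<Longrightarrow> a + b \<in> T"
    "a \<in> T \<Longrightarrow> b \<in> T \<Longrightarrow> a - b \<in> T" "a \<in> T \<Longrightarrow> b \<in> T \<Longrightarrow> a * b \<in> T"
    "a \<in> T \<Longrightarrow> a ^ k \<in> T"
    "(\<And>x. x \<in> A \<Longrightarrow> F x \<in> T) \<Longrightarrow> sum F A \<in> T" "(\<And>x. x \<in> A \<Longrightarrow> F x \<in> T) \<Longrightarrow> prod F A \<in> T"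
proof -
  note * = assms[unfolded is_subring_def]
  show 1: "1 \<in> T" and "a \<in> T \<Longrightarrow> - a \<in> T" and
    "a \<in> T \<Longrightarrow> b \<in> T \<Longrightarrow> a + b \<in> T" and 2: "a \<in> T \<Longrightarrow> b \<in> T \<Longrightarrow> a * b \<in> T" using * by auto
  show 0: "0 \<in> T" using * by (metis add.right_inverse)
  show "a \<in> T \<Longrightarrow> b \<in> T \<Longrightarrow> a - b \<in> T"
    unfolding diff_conv_add_uminus using * by blast
  show "a \<in> T \<Longrightarrow> a ^ k \<in> T" using * by (induction k) auto
  show "(\<And>x. x \<in> A \<Longrightarrow> F x \<in> T) \<Longrightarrow> sum F A \<in> T"
    using * 0 by (induction A rule: infinite_finite_induct) auto
  show "(\<And>x. x \<in> A \<Longrightarrow> F x \<in> T) \<Longrightarrow> prod F A \<in> T"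
    using * 0 by (induction A rule: infinite_finite_induct) auto
qed

text \<open>Polynomial rings and the rings of the tower are all of this form, so statements about
  them reduce to constants and generators.\<close>

inductive_set gen_alg :: "'k::comm_ring_1 mpol set \<Rightarrow> 'k mpol set" for Y where
  Const: "Const c \<in> gen_alg Y"
| gen: "y \<in> Y \<Longrightarrow> y \<in> gen_alg Y"
| add: "a \<in> gen_alg Y \<Longrightarrow> b \<in> gen_alg Y \<Longrightarrow> a + b \<in> gen_alg Y"
| mult: "a \<in> gen_alg Y \<Longrightarrow> b \<in> gen_alg Y \<Longrightarrow> a * b \<in> gen_alg Y"

lemma is_subring_gen_alg: "is_subring (gen_alg Y)"
proof -
  interpret comm_ring_hom Const by (rule Const_comm_ring_hom)
  have "1 \<in> gen_alg Y" using gen_alg.Const[of 1 Y] by simp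
  moreover have "- a \<in> gen_alg Y" if "a \<in> gen_alg Y" for a
    using gen_alg.mult[OF gen_alg.Const[of "-1" Y] that] by (simp add: hom_uminus)
  ultimately show ?thesis by (auto simp: is_subring_def gen_alg.add gen_alg.mult)
qed

lemma mpoly_ring_simps [simp]:
  "x \<otimes>\<^bsub>mpoly_ring n\<^esub> y = x * y" "x \<oplus>\<^bsub>mpoly_ring n\<^esub> y = x + y"
  "\<one>\<^bsub>mpoly_ring n\<^esub> = 1" "\<zero>\<^bsub>mpoly_ring n\<^esub> = 0"
  by (simp_all add: mpoly_ring_def)

lemma carrier_mpoly_ring:
  "carrier (mpoly_ring n :: 'k::comm_ring_1 mpol ring) = gen_alg (Var ` {..<n})"
proof (intro equalityI subsetI)
  fix f :: "'k mpol" assume f: "f \<in> carrier (mpoly_ring n)"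
  have "peval Const Var f \<in> gen_alg (Var ` {..<n})"
    unfolding peval_def mexp_def using f
    by (intro is_subringD[OF is_subring_gen_alg]) (auto simp: mpoly_ring_def intro: gen_alg.intros)
  then show "f \<in> gen_alg (Var ` {..<n})" by (simp add: peval_Const_Var)
next
  fix f :: "'k mpol" assume "f \<in> gen_alg (Var ` {..<n})"
  then show "f \<in> carrier (mpoly_ring n)"
  proof induction
    case (Const c)
    then show ?case by (cases "c = 0") (auto simp: mpoly_ring_def Const_def)
  next
    case (gen y)
    then show ?case by (auto simp: mpoly_ring_def Var_def)
  next
    case (add a b)
    then show ?case using keys_add[of a b] by (auto simp: mpoly_ring_def)
  next
    case (mult a b)
    show ?case unfolding mpoly_ring_def partial_object.select_convs mem_Collect_eq
    proof
      fix l assume "l \<in> Poly_Mapping.keys (a * b)"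
      then obtain m m' where "l = m + m'" "m \<in> Poly_Mapping.keys a" "m' \<in> Poly_Mapping.keys b"
        using keys_mult[of a b] by blast
      with mult.IH show "Poly_Mapping.keys l \<subseteq> {..<n}"
        using keys_add[of m m'] by (simp add: mpoly_ring_def) blast
    qed
  qed
qed

lemma is_subring_carrier: "is_subring (carrier (mpoly_ring n))"
  by (simp add: carrier_mpoly_ring is_subring_gen_alg)

lemmas subring_carrier = is_subringD[OF is_subring_carrier]

lemma Const_in_carrier: "Const c \<in> carrier (mpoly_ring n)"
  by (simp add: carrier_mpoly_ring gen_alg.Const)

lemma Var_in_carrier: "i < n \<Longrightarrow> Var i \<in> carrier (mpoly_ring n)"
  by (auto simp: carrier_mpoly_ring intro: gen_alg.gen)

lemma cring_mpoly_ring: "cring (mpoly_ring n :: 'k::comm_ring_1 mpol ring)"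
proof (intro cringI abelian_groupI comm_monoidI)
  fix x :: "'k mpol" assume x: "x \<in> carrier (mpoly_ring n)"
  show "\<exists>y\<in>carrier (mpoly_ring n). y \<oplus>\<^bsub>mpoly_ring n\<^esub> x = \<zero>\<^bsub>mpoly_ring n\<^esub>"
    by (rule bexI[of _ "- x"]) (use x in \<open>auto intro: subring_carrier(3)\<close>)
qed (simp_all add: subring_carrier(1,2,4,6) add.assoc mult.assoc distrib_right)

lemma comm_ring_hom_eq_on_gen_alg:
  assumes "comm_ring_hom \<phi>" "comm_ring_hom \<psi>" "f \<in> gen_alg Y"
    "\<And>c. \<phi> (Const c) = \<psi> (Const c)" "\<And>y. y \<in> Y \<Longrightarrow> \<phi> y = \<psi> y"
  shows "\<phi> f = \<psi> f"
proof -
  interpret \<phi>: comm_ring_hom \<phi> by fact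
  interpret \<psi>: comm_ring_hom \<psi> by fact
  show ?thesis using assms(3)
    by induction (simp_all add: assms \<phi>.hom_add \<phi>.hom_mult \<psi>.hom_add \<psi>.hom_mult)
qed

lemma comm_ring_hom_image_gen_alg:
  assumes "comm_ring_hom \<phi>" "is_subring T" "f \<in> gen_alg Y"
    "\<And>c. \<phi> (Const c) \<in> T" "\<And>y. y \<in> Y \<Longrightarrow> \<phi> y \<in> T"
  shows "\<phi> f \<in> T"
proof -
  interpret \<phi>: comm_ring_hom \<phi> by fact
  show ?thesis using assms(3)
    by induction (use assms is_subringD[OF assms(2)] in \<open>simp_all add: \<phi>.hom_add \<phi>.hom_mult\<close>)
qed

lemma comm_ring_hom_compose:
  "comm_ring_hom \<phi> \<Longrightarrow> comm_ring_hom \<psi> \<Longrightarrow> comm_ring_hom (\<lambda>x. \<psi> (\<phi> x))"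
proof -
  assume "comm_ring_hom \<phi>" "comm_ring_hom \<psi>"
  then interpret \<phi>: comm_ring_hom \<phi> + \<psi>: comm_ring_hom \<psi> .
  show ?thesis by unfold_locales
      (simp_all add: \<phi>.hom_add \<phi>.hom_mult \<psi>.hom_add \<psi>.hom_mult)
qed

lemma comm_ring_hom_id: "comm_ring_hom (\<lambda>x. x)"
  by unfold_locales simp_all

section \<open>The Moore determinant and the vanishing polynomial of a span\<close>

text \<open>Makes the Frobenius maps of the polynomial ring additive, not only those of the
  field.\<close>

lemma CHAR_mpol: "CHAR('k::comm_ring_1 mpol) = CHAR('k)"
proof (rule CHAR_eqI)
  interpret comm_ring_hom "Const :: 'k \<Rightarrow> 'k mpol" by (rule Const_comm_ring_hom)
  have *: "(of_nat n :: 'k mpol) = Const (of_nat n)" for n by (simp add: hom_of_nat)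
  show "(of_nat CHAR('k) :: 'k mpol) = 0" by (simp add: *)
  fix n assume "(of_nat n :: 'k mpol) = 0"
  then have "Const (of_nat n :: 'k) = Const 0" by (simp add: *)
  then show "CHAR('k) dvd n" by (simp only: of_nat_eq_0_iff_char_dvd injD[OF inj_Const, of "of_nat n" 0] inj_eq[OF inj_Const])
qed

text \<open>The map \<open>\<phi>\<close> embeds the scalars: it is \<open>Const\<close> for the
  generic forms and the identity for their values at a point, so both cases share the theory of
  Moore determinants.\<close>

definition lin :: "('k \<Rightarrow> 'a::comm_ring_1) \<Rightarrow> (nat \<Rightarrow> 'a) \<Rightarrow> nat \<Rightarrow> (nat \<Rightarrow> 'k) \<Rightarrow> 'a" where
  "lin \<phi> x m v = (\<Sum>i<m. \<phi> (v i) * x i)"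

definition moore :: "nat \<Rightarrow> (nat \<Rightarrow> 'a::comm_ring_1) \<Rightarrow> nat \<Rightarrow> 'a" where
  "moore q x m = det (mat m m (\<lambda>(i, j). x i ^ (q ^ j)))"

lemma moore_det_eq: "moore_det q n = moore q Var n"
  by (simp add: moore_det_def moore_def)

lemma lin_cong: "(\<And>i. i < m \<Longrightarrow> v i = v' i) \<Longrightarrow> lin \<phi> x m v = lin \<phi> x m v'"
  by (simp add: lin_def)

text \<open>The cardinality of \<open>Fq q\<close> is assumed here, which keeps the descent
  independent of algebraic closedness; \<open>card_Fq\<close> discharges it for the concrete
  field.\<close>

locale finite_subfield =
  fixes q p s :: nat and ty :: "'k::field itself"
  assumes prime_p: "normalization_semidom_class.prime p" and CHAR_k: "CHAR('k) = p" and s: "s \<ge> 1" and q: "q = p ^ s"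
    and card_K: "card (Fq q :: 'k set) = q"
begin

abbreviation K :: "'k set" where "K \<equiv> Fq q"

lemma q_ge_2: "q \<ge> 2"
proof -
  have "p ^ 1 \<le> p ^ s" using prime_p s by (intro power_increasing) (simp_all add: prime_gt_0_nat Suc_le_eq)
  then show ?thesis using prime_ge_2_nat[OF prime_p] q by simp
qed

lemma finite_K: "finite K"
  using card_K q_ge_2 by (intro card_ge_0_finite) simp

lemma power_q_add:
  fixes a b :: "'a::comm_ring_1"
  assumes "CHAR('a) = p"
  shows "(a + b) ^ (q ^ j) = a ^ (q ^ j) + b ^ (q ^ j)"
  using freshmans_dream'[of "q ^ j" "s * j" a b] assms prime_p q by (simp add: power_mult)

lemma power_q_comm_ring_hom:
  assumes "CHAR('a::comm_ring_1) = p"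
  shows "comm_ring_hom (\<lambda>a::'a. a ^ (q ^ j))"
proof
  have "q ^ j \<noteq> 0" using q_ge_2 by simp
  then show "(0::'a) ^ q ^ j = 0" by (simp add: power_0_left)
qed (simp_all add: power_q_add[OF assms] power_mult_distrib)

lemma K_power: "c \<in> K \<Longrightarrow> c ^ (q ^ j) = c"
  by (induction j) (simp_all add: Fq_def power_mult)

lemma K_closed [intro]:
  "0 \<in> K" "1 \<in> K" "a \<in> K \<Longrightarrow> b \<in> K \<Longrightarrow> a + b \<in> K" "a \<in> K \<Longrightarrow> b \<in> K \<Longrightarrow> a * b \<in> K"
  "a \<in> K \<Longrightarrow> inverse a \<in> K" "a \<in> K \<Longrightarrow> - a \<in> K" "a \<in> K \<Longrightarrow> b \<in> K \<Longrightarrow> a - b \<in> K"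
proof -
  interpret comm_ring_hom "\<lambda>a::'k. a ^ q"
    using power_q_comm_ring_hom[of 1, OF CHAR_k] by simp
  show "0 \<in> K" "1 \<in> K" "a \<in> K \<Longrightarrow> b \<in> K \<Longrightarrow> a + b \<in> K" "a \<in> K \<Longrightarrow> b \<in> K \<Longrightarrow> a * b \<in> K"
    "a \<in> K \<Longrightarrow> inverse a \<in> K" "a \<in> K \<Longrightarrow> - a \<in> K" "a \<in> K \<Longrightarrow> b \<in> K \<Longrightarrow> a - b \<in> K"
    by (simp_all add: Fq_def hom_add power_mult_distrib power_inverse hom_uminus hom_minus)
qed

lemma K_sum: "(\<And>i. i \<in> A \<Longrightarrow> f i \<in> K) \<Longrightarrow> sum f A \<in> K"
  by (induction A rule: infinite_finite_induct) auto

definition Fspan :: "('k \<Rightarrow> 'a::comm_ring_1) \<Rightarrow> (nat \<Rightarrow> 'a) \<Rightarrow> nat \<Rightarrow> 'a set" where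
  "Fspan \<phi> x m = lin \<phi> x m ` ({..<m} \<rightarrow>\<^sub>E K)"

text \<open>For a homomorphism \<open>\<phi>\<close> this is linear independence over the field
  \<open>K\<close>, in a form suited to induction and to choosing bases greedily.\<close>

definition Findep :: "('k \<Rightarrow> 'a::comm_ring_1) \<Rightarrow> (nat \<Rightarrow> 'a) \<Rightarrow> nat \<Rightarrow> bool" where
  "Findep \<phi> x n \<longleftrightarrow> (\<forall>i<n. x i \<notin> Fspan \<phi> x i)"

lemma lin_in_Fspan: "(\<And>i. i < m \<Longrightarrow> v i \<in> K) \<Longrightarrow> lin \<phi> x m v \<in> Fspan \<phi> x m"
  unfolding Fspan_def
  by (rule image_eqI[of _ _ "restrict v {..<m}"]) (auto intro: lin_cong)

lemma FspanE:
  assumes "w \<in> Fspan \<phi> x m"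
  obtains v where "\<And>i. i < m \<Longrightarrow> v i \<in> K" "w = lin \<phi> x m v"
  using assms by (auto simp: Fspan_def)

lemma finite_Fspan: "finite (Fspan \<phi> x m)"
  by (auto simp: Fspan_def intro!: finite_PiE finite_K)

definition moore_cofactor :: "(nat \<Rightarrow> 'a::comm_ring_1) \<Rightarrow> nat \<Rightarrow> nat \<Rightarrow> 'a" where
  "moore_cofactor x m j = cofactor (mat (Suc m) (Suc m) (\<lambda>(i, j). x i ^ (q ^ j))) m j"

text \<open>The Moore determinant of the first m entries and an indeterminate X, expanded along the
  row of X.\<close>

definition bordered :: "(nat \<Rightarrow> 'a::comm_ring_1) \<Rightarrow> nat \<Rightarrow> 'a poly" where
  "bordered x m = (\<Sum>j<Suc m. Polynomial.monom (moore_cofactor x m j) (q ^ j))"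

text \<open>The factors are X + w as in the Dickson product. The roots are the elements -w, which
  run through the same span.\<close>

definition vanishing :: "('k \<Rightarrow> 'a) \<Rightarrow> (nat \<Rightarrow> 'a::comm_ring_1) \<Rightarrow> nat \<Rightarrow> 'a poly" where
  "vanishing \<phi> x m = (\<Prod>w\<in>Fspan \<phi> x m. [:w, 1:])"

context
  fixes \<phi> :: "'k \<Rightarrow> 'a::idom"
  assumes \<phi>: "comm_ring_hom \<phi>"
begin

interpretation \<phi>: comm_ring_hom \<phi> by (rule \<phi>)

lemma lin_diff: "lin \<phi> x m v - lin \<phi> x m v' = lin \<phi> x m (\<lambda>i. v i - v' i)"
  by (simp add: lin_def \<phi>.hom_minus algebra_simps sum_subtractf)

lemma lin_scale: "\<phi> c * lin \<phi> x m v = lin \<phi> x m (\<lambda>i. c * v i)"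
  by (simp add: lin_def \<phi>.hom_mult algebra_simps sum_distrib_left)

lemma Fspan_diff:
  assumes "a \<in> Fspan \<phi> x m" "b \<in> Fspan \<phi> x m"
  shows "a - b \<in> Fspan \<phi> x m"
  using assms by (elim FspanE) (auto simp: lin_diff intro: lin_in_Fspan)

lemma Fspan_scale:
  assumes "a \<in> Fspan \<phi> x m" "c \<in> K"
  shows "\<phi> c * a \<in> Fspan \<phi> x m"
  using assms by (elim FspanE) (auto simp: lin_scale intro: lin_in_Fspan)

lemma Fspan_uminus: "a \<in> Fspan \<phi> x m \<Longrightarrow> - a \<in> Fspan \<phi> x m"
  using Fspan_scale[of a x m "- 1"] by (auto simp: \<phi>.hom_uminus)

text \<open>If the last coefficients differed, dividing by their difference, a unit of
  \<open>K\<close>, would put the last element into the span of the earlier ones.\<close>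

lemma lin_inj:
  assumes "Findep \<phi> x n" "\<And>i. i < n \<Longrightarrow> v i \<in> K" "\<And>i. i < n \<Longrightarrow> v' i \<in> K"
    "lin \<phi> x n v = lin \<phi> x n v'" "i < n"
  shows "v i = v' i"
  using assms
proof (induction n)
  case (Suc n)
  let ?c = "v n - v' n"
  have eq: "\<phi> ?c * x n = lin \<phi> x n (\<lambda>i. v' i - v i)"
    using Suc.prems(4) unfolding lin_diff[symmetric] by (simp add: lin_def \<phi>.hom_minus algebra_simps)
  have "v n = v' n"
  proof (rule ccontr)
    assume "v n \<noteq> v' n"
    then have "\<phi> (inverse ?c) * (\<phi> ?c * x n) = x n"
      by (simp only: mult.assoc[symmetric] \<phi>.hom_mult[symmetric]) simp
    moreover have "\<phi> (inverse ?c) * (\<phi> ?c * x n) \<in> Fspan \<phi> x n"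
      unfolding eq using Suc.prems(2,3) by (intro Fspan_scale lin_in_Fspan) auto
    ultimately have "x n \<in> Fspan \<phi> x n" by (simp only:)
    then show False using Suc.prems(1) by (simp add: Findep_def)
  qed
  moreover have "v i = v' i" if "i < n"
  proof (rule Suc.IH)
    show "lin \<phi> x n v = lin \<phi> x n v'"
      using Suc.prems(4) \<open>v n = v' n\<close> by (simp add: lin_def)
  qed (use Suc.prems that in \<open>auto simp: Findep_def\<close>)
  ultimately show ?case using Suc.prems(5) by (cases "i = n") auto
qed simp

lemma inj_on_lin: "Findep \<phi> x n \<Longrightarrow> inj_on (lin \<phi> x n) ({..<n} \<rightarrow>\<^sub>E K)"
  by (intro inj_onI PiE_ext[where k = "{..<n}" and s = "\<lambda>_. K"])
    (auto intro: lin_inj[of x n] simp: PiE_def Pi_def)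

lemma card_Fspan: "Findep \<phi> x n \<Longrightarrow> card (Fspan \<phi> x n) = q ^ n"
  unfolding Fspan_def by (simp add: card_image[OF inj_on_lin] card_PiE card_K)

lemma prod_lin_eq_prod_Fspan:
  "Findep \<phi> x n \<Longrightarrow> (\<Prod>v\<in>{..<n} \<rightarrow>\<^sub>E K. f (lin \<phi> x n v)) = prod f (Fspan \<phi> x n)"
  unfolding Fspan_def by (simp add: prod.reindex[OF inj_on_lin])

text \<open>Row m is deleted in these cofactors, so \<open>bordered x m\<close> does not depend on
  \<open>x m\<close>, which may be replaced by anything.\<close>

lemma moore_cofactor_upd: "moore_cofactor (x(m := y)) m j = moore_cofactor x m j"
  unfolding moore_cofactor_def cofactor_def mat_delete_def
  by (intro arg_cong2[where f = "(*)"] refl arg_cong[where f = det] cong_mat) auto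

lemma moore_upd_eq: "moore q (x(m := y)) (Suc m) = poly (bordered x m) y"
proof -
  let ?A = "mat (Suc m) (Suc m) (\<lambda>(i, j). (x(m := y)) i ^ (q ^ j))"
  have "moore q (x(m := y)) (Suc m) = (\<Sum>j<Suc m. ?A $$ (m, j) * cofactor ?A m j)"
    unfolding moore_def by (rule laplace_expansion_row) auto
  also have "\<dots> = (\<Sum>j<Suc m. y ^ (q ^ j) * moore_cofactor (x(m := y)) m j)"
    unfolding moore_cofactor_def by (rule sum.cong) auto
  also have "\<dots> = poly (bordered x m) y"
    by (simp only: moore_cofactor_upd bordered_def poly_sum poly_monom mult.commute)
  finally show ?thesis .
qed

lemma moore_Suc_eq: "moore q x (Suc m) = poly (bordered x m) (x m)"
  using moore_upd_eq[of x m "x m"] by simp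

lemma moore_cofactor_last: "moore_cofactor x m m = moore q x m"
proof -
  have "mat_delete (mat (Suc m) (Suc m) (\<lambda>(i, j). x i ^ (q ^ j))) m m = mat m m (\<lambda>(i, j). x i ^ (q ^ j))"
    by (rule eq_matI) (auto simp: mat_delete_def)
  then show ?thesis by (simp add: moore_cofactor_def cofactor_def moore_def)
qed

context
  assumes CHAR_a: "CHAR('a) = p"
begin

text \<open>Deleting the column of first powers leaves the exponents q, ..., q^m, the entrywise q-th
  power of the Moore matrix of size m. Frobenius is a ring homomorphism and passes through the
  determinant.\<close>

lemma moore_cofactor_0:
  fixes x :: "nat \<Rightarrow> 'a"
  shows "moore_cofactor x m 0 = (- 1) ^ m * moore q x m ^ q"
proof -
  interpret frob: comm_ring_hom "\<lambda>a::'a. a ^ q"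
    using power_q_comm_ring_hom[of 1, OF CHAR_a] by simp
  have "mat_delete (mat (Suc m) (Suc m) (\<lambda>(i, j). x i ^ (q ^ j))) m 0
      = map_mat (\<lambda>a. a ^ q) (mat m m (\<lambda>(i, j). x i ^ (q ^ j)))"
    by (rule eq_matI) (auto simp: mat_delete_def power_mult[symmetric] mult.commute)
  then show ?thesis by (simp add: moore_cofactor_def cofactor_def moore_def)
qed

text \<open>Coefficients in \<open>K\<close> are fixed by Frobenius, so the relation between w and
  the \<open>x i\<close> persists among their q^j-th powers, that is, between the rows of the
  matrix.\<close>

lemma bordered_root:
  assumes "w \<in> Fspan \<phi> x m"
  shows "poly (bordered x m) w = 0"
proof -
  from assms obtain v where v: "\<And>i. i < m \<Longrightarrow> v i \<in> K" and w: "w = lin \<phi> x m v"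
    by (elim FspanE) auto
  let ?A = "mat (Suc m) (Suc m) (\<lambda>(i, j). (x(m := w)) i ^ (q ^ j))"
  \<comment> \<open>The relation among the rows; the entry -1 keeps it nontrivial even if all
    \<open>v i\<close> vanish.\<close>
  define u where "u = vec (Suc m) (\<lambda>i. if i < m then \<phi> (v i) else - 1)"
  have wq: "w ^ (q ^ j) = (\<Sum>i<m. x i ^ (q ^ j) * \<phi> (v i))" for j
  proof -
    interpret frob: comm_ring_hom "\<lambda>a::'a. a ^ (q ^ j)"
      by (rule power_q_comm_ring_hom[OF CHAR_a])
    have "\<phi> (v i) ^ (q ^ j) = \<phi> (v i)" if "i < m" for i
      using K_power[OF v[OF that]] by (simp flip: \<phi>.hom_power)
    then show ?thesis by (simp add: w lin_def frob.hom_sum power_mult_distrib mult.commute)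
  qed
  have "?A\<^sup>T *\<^sub>v u = 0\<^sub>v (Suc m)"
  proof (rule eq_vecI)
    fix j assume "j < dim_vec (0\<^sub>v (Suc m) :: 'a vec)"
    then have j: "j < Suc m" by simp
    have "(?A\<^sup>T *\<^sub>v u) $ j = (\<Sum>i<Suc m. (x(m := w)) i ^ (q ^ j) * (if i < m then \<phi> (v i) else - 1))"
      using j by (simp add: u_def scalar_prod_def atLeast0LessThan)
    also have "\<dots> = 0" by (simp add: wq)
    finally show "(?A\<^sup>T *\<^sub>v u) $ j = 0\<^sub>v (Suc m) $ j" using j by simp
  qed simp
  moreover have "u \<noteq> 0\<^sub>v (Suc m)"
  proof
    assume "u = 0\<^sub>v (Suc m)"
    then have "u $ m = 0" by simp
    then show False by (simp add: u_def)
  qed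
  ultimately have "det (?A\<^sup>T) = 0"
    by (subst det_0_iff_vec_prod_zero[of _ "Suc m"]) (auto simp: u_def intro!: exI[of _ u])
  then have "det ?A = 0" by (subst (asm) det_transpose[of _ "Suc m"]) auto
  then show ?thesis by (simp add: moore_upd_eq[symmetric] moore_def)
qed

lemma coeff_bordered:
  "poly.coeff (bordered x m) k = (\<Sum>j<Suc m. if q ^ j = k then moore_cofactor x m j else 0)"
  by (simp only: bordered_def coeff_sum coeff_monom)

lemma coeff_bordered_power: "j \<le> m \<Longrightarrow> poly.coeff (bordered x m) (q ^ j) = moore_cofactor x m j"
  unfolding coeff_bordered using q_ge_2 by (simp add: power_inject_exp less_Suc_eq_le)

text \<open>Both sides have degree at most q^m, equal coefficients at X^(q^m) and the q^m elements
  of the span as common zeros, so their difference has too many roots for its degree.\<close>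

lemma bordered_eq:
  assumes "Findep \<phi> x m"
  shows "bordered x m = Polynomial.smult (moore q x m) (vanishing \<phi> x m)"
proof (rule poly_eqI_degree_lead_coeff[where n = "q ^ m" and A = "Fspan \<phi> x m"])
  have deg: "Polynomial.degree (vanishing \<phi> x m) = q ^ m" 
    unfolding vanishing_def by (subst degree_prod_eq_sum_degree) (auto simp: card_Fspan[OF assms])
  have "Polynomial.lead_coeff (vanishing \<phi> x m) = 1"
    unfolding vanishing_def by (simp add: Polynomial.lead_coeff_prod)
  then show "poly.coeff (bordered x m) (q ^ m)
      = poly.coeff (Polynomial.smult (moore q x m) (vanishing \<phi> x m)) (q ^ m)"
    by (simp add: coeff_bordered_power moore_cofactor_last deg)
  show "Polynomial.degree (Polynomial.smult (moore q x m) (vanishing \<phi> x m)) \<le> q ^ m"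
    using degree_smult_le[of "moore q x m" "vanishing \<phi> x m"] deg by simp
  show "Polynomial.degree (bordered x m) \<le> q ^ m"
    unfolding bordered_def using q_ge_2
    by (intro degree_sum_le) (auto intro: order.trans[OF degree_monom_le] power_increasing)
  show "q ^ m \<le> card (Fspan \<phi> x m)" by (simp add: card_Fspan[OF assms])
  fix z assume z: "z \<in> Fspan \<phi> x m"
  have "poly (vanishing \<phi> x m) z = 0"
    unfolding vanishing_def poly_prod
    by (rule prod_zero[OF finite_Fspan bexI[of _ "- z"]]) (use Fspan_uminus[OF z] in auto)
  then show "poly (bordered x m) z = poly (Polynomial.smult (moore q x m) (vanishing \<phi> x m)) z"
    by (simp add: bordered_root[OF z])
qed

text \<open>By \<open>bordered_eq\<close>, adding \<open>x m\<close> multiplies the determinant by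
  the product of all \<open>x m + w\<close> with w in the span, and independence makes each factor
  nonzero.\<close>

lemma moore_nonzero:
  assumes "Findep \<phi> x m"
  shows "moore q x m \<noteq> 0"
  using assms
proof (induction m)
  case 0
  then show ?case by (simp add: moore_def)
next
  case (Suc m)
  then have ind: "Findep \<phi> x m" and nin: "x m \<notin> Fspan \<phi> x m" by (auto simp: Findep_def)
  have "x m + w \<noteq> 0" if "w \<in> Fspan \<phi> x m" for w
    using nin Fspan_uminus[OF that] by (metis add_eq_0_iff2)
  then show ?case
    using Suc.IH[OF ind]
    by (simp add: moore_Suc_eq bordered_eq[OF ind] vanishing_def poly_prod finite_Fspan add.commute)
qed

text \<open>Compare the coefficients of X = X^(q^0) in \<open>bordered_eq\<close>: cancelling one
  factor of the Moore determinant lowers the exponent q from \<open>moore_cofactor_0\<close> to q -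
  1.\<close>

lemma coeff_vanishing_1:
  assumes "Findep \<phi> x m"
  shows "poly.coeff (vanishing \<phi> x m) 1 = (- 1) ^ m * moore q x m ^ (q - 1)"
proof -
  have "moore q x m * poly.coeff (vanishing \<phi> x m) 1 = poly.coeff (bordered x m) (q ^ 0)"
    by (simp add: bordered_eq[OF assms])
  also have "\<dots> = (- 1) ^ m * (moore q x m * moore q x m ^ (q - 1))"
    using q_ge_2 by (subst coeff_bordered_power) (auto simp: moore_cofactor_0 simp flip: power_Suc)
  finally show ?thesis using moore_nonzero[OF assms] by (simp add: mult.left_commute)
qed

lemma coeff_vanishing_eq_0:
  assumes "Findep \<phi> x m" "\<And>j. j \<le> m \<Longrightarrow> k \<noteq> q ^ j"
  shows "poly.coeff (vanishing \<phi> x m) k = 0"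
proof -
  have "moore q x m * poly.coeff (vanishing \<phi> x m) k = poly.coeff (bordered x m) k"
    by (simp add: bordered_eq[OF assms(1)])
  also have "\<dots> = 0"
    unfolding coeff_bordered
    by (rule sum.neutral) (metis assms(2) lessThan_iff less_Suc_eq_le)
  finally show ?thesis using moore_nonzero[OF assms(1)] by simp
qed

end
end
end

section \<open>Separable additive polynomials over an algebraically closed field\<close>

lemma alg_closed_card_roots:
  fixes f :: "'k::alg_closed_field poly"
  assumes "pderiv f = [:c:]" "c \<noteq> 0"
  shows "card {x. poly f x = 0} = Polynomial.degree f"
proof -
  have f0: "f \<noteq> 0" using assms by auto
  obtain A where A: "size A = Polynomial.degree f"
    "f = Polynomial.smult (Polynomial.lead_coeff f) (\<Prod>x\<in>#A. [:-x, 1:])"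
    using alg_closed_imp_factorization[OF f0] by blast
  have "poly f x = 0 \<longleftrightarrow> x \<in># A" for x
    using f0 by (subst A(2))
      (auto simp: poly_prod_mset image_mset.compositionality o_def prod_mset_zero_iff)
  then have roots: "{x. poly f x = 0} = set_mset A" by auto
  \<comment> \<open>A repeated root would also be a root of the derivative, which is a nonzero
    constant.\<close>
  have "count A x \<le> 1" for x
  proof (rule ccontr)
    assume "\<not> count A x \<le> 1"
    then have "{#x, x#} \<subseteq># A" by (auto simp: subseteq_mset_def)
    then obtain B where "A = {#x, x#} + B" by (metis subset_mset.le_iff_add)
    then obtain g where g: "f = [:-x, 1:] * ([:-x, 1:] * g)"
      using A(2) by (metis (no_types, lifting) add_mset_add_single image_mset_add_mset
        mult_smult_right prod_mset.add_mset union_mset_add_mset_left add.left_neutral add_cancel_left_left)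
    have "poly (pderiv f) x = 0" by (subst g, simp only: pderiv_mult) simp
    then show False using assms by simp
  qed
  then have "A = mset_set (set_mset A)"
    by (intro multiset_eqI) (metis (mono_tags, lifting) count_eq_zero_iff count_mset_set(1,3)
      finite_set_mset le_antisym less_one not_le)
  then have "size A = card (set_mset A)" by (metis size_mset_set)
  with A(1) roots show ?thesis by simp
qed

context finite_subfield
begin

lemma Fspan_cong: "(\<And>i. i < m \<Longrightarrow> x i = x' i) \<Longrightarrow> Fspan \<phi> x m = Fspan \<phi> x' m"
  unfolding Fspan_def lin_def by (intro image_cong refl sum.cong) auto

definition additive_poly :: "nat \<Rightarrow> (nat \<Rightarrow> 'a::comm_ring_1) \<Rightarrow> 'a poly" where
  "additive_poly n g = (\<Sum>i<Suc n. Polynomial.monom (g i) (q ^ i))"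

lemma coeff_additive_poly: "i \<le> n \<Longrightarrow> poly.coeff (additive_poly n g) (q ^ i) = g i"
  using q_ge_2 by (simp add: additive_poly_def coeff_sum power_inject_exp less_Suc_eq_le)

lemma degree_additive_poly:
  assumes "g n = 1"
  shows "Polynomial.degree (additive_poly n g) = q ^ n"
proof (rule antisym)
  show "Polynomial.degree (additive_poly n g) \<le> q ^ n"
    unfolding additive_poly_def using q_ge_2
    by (intro degree_sum_le) (auto intro: order.trans[OF degree_monom_le] power_increasing)
  show "q ^ n \<le> Polynomial.degree (additive_poly n g)"
    by (rule le_degree) (simp add: coeff_additive_poly assms)
qed

text \<open>The derivative of X^(q^i) has the factor q^i, which is zero in characteristic p unless i
  = 0.\<close>

lemma pderiv_additive_poly: "pderiv (additive_poly n g) = [:g 0 :: 'k:]"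
proof -
  have "(of_nat q :: 'k) = 0"
    unfolding of_nat_eq_0_iff_char_dvd CHAR_k using s q by simp
  then have "pderiv (additive_poly n g) = (\<Sum>i<Suc n. if i = 0 then [:g 0:] else 0)"
    unfolding additive_poly_def pderiv_sum by (intro sum.cong) (auto simp: pderiv_monom monom_0)
  then show ?thesis by simp
qed

lemma additive_poly_diff:
  "poly (additive_poly n g) (a - b) = poly (additive_poly n g) a - poly (additive_poly n g) (b :: 'k)"
proof -
  have "(a - b) ^ (q ^ i) = a ^ (q ^ i) - b ^ (q ^ i)" for i
  proof -
    interpret comm_ring_hom "\<lambda>a::'k. a ^ (q ^ i)" by (rule power_q_comm_ring_hom[OF CHAR_k])
    show ?thesis by (rule hom_minus)
  qed
  then show ?thesis
    by (simp only: additive_poly_def poly_sum poly_monom sum_subtractf right_diff_distrib)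
qed

lemma additive_poly_scale:
  "c \<in> K \<Longrightarrow> poly (additive_poly n g) (c * a) = c * poly (additive_poly n g) (a :: 'k)"
  by (simp only: additive_poly_def poly_sum poly_monom power_mult_distrib K_power
      sum_distrib_left mult.left_commute)

end

locale finite_subfield_alg_closed = finite_subfield q p s ty
  for q p s and ty :: "'k::alg_closed_field itself"
begin

text \<open>The roots of a separable additive polynomial form a vector space over \<open>K\<close>, so the
  polynomial is the vanishing polynomial of a basis of that space.\<close>

lemma additive_poly_eq_vanishing:
  fixes g :: "nat \<Rightarrow> 'k"
  assumes "g n = 1" "g 0 \<noteq> 0"
  obtains x where "Findep (\<lambda>c. c) x n" "vanishing (\<lambda>c. c) x n = additive_poly n g"
proof -
  let ?G = "additive_poly n g"
  define V where "V = {z. poly ?G z = 0}"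
  note id = comm_ring_hom_id[where 'a = 'k]
  have V: "card V = q ^ n"
    unfolding V_def using alg_closed_card_roots[OF pderiv_additive_poly[of n g] assms(2)]
    by (simp add: degree_additive_poly[of g n, OF assms(1)])
  have fin: "finite V" using V q_ge_2 by (intro card_ge_0_finite) simp
  have diff: "a - b \<in> V" if "a \<in> V" "b \<in> V" for a b
    using that by (simp add: V_def additive_poly_diff)
  have scale: "c * a \<in> V" if "a \<in> V" "c \<in> K" for a c
    using that by (simp add: V_def additive_poly_scale)
  \<comment> \<open>V is nonempty because it has q^n elements; scaling any of them by 0 gives
    0.\<close>
  have zero: "0 \<in> V" using scale[of _ 0] V q_ge_2
    by (metis K_closed(1) card.empty equals0I mult_zero_left not_numeral_le_zero power_eq_0_iff)
  have add: "a + b \<in> V" if "a \<in> V" "b \<in> V" for a b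
    using diff[OF that(1) diff[OF zero that(2)]] by simp
  \<comment> \<open>A basis is chosen greedily: for m < n the span has only q^m < q^n elements, so
    some element of V lies outside it.\<close>
  have "\<exists>x. (\<forall>i<m. x i \<in> V) \<and> Findep (\<lambda>c. c) x m" if "m \<le> n" for m
    using that
  proof (induction m)
    case 0
    then show ?case by (simp add: Findep_def)
  next
    case (Suc m)
    then obtain x where x: "\<forall>i<m. x i \<in> V" "Findep (\<lambda>c. c) x m" by auto
    have "card (Fspan (\<lambda>c. c) x m) < card V"
      using card_Fspan[OF id x(2)] Suc.prems q_ge_2 by (simp add: V)
    then obtain v where v: "v \<in> V" "v \<notin> Fspan (\<lambda>c. c) x m"
      by (meson card_mono finite_Fspan not_le subsetI)
    have "Fspan (\<lambda>c. c) (x(m := v)) i = Fspan (\<lambda>c. c) x i" if "i \<le> m" for i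
      using that by (intro Fspan_cong) auto
    then have "Findep (\<lambda>c. c) (x(m := v)) (Suc m)"
      using x(2) v(2) by (auto simp: Findep_def less_Suc_eq)
    moreover have "\<forall>i<Suc m. (x(m := v)) i \<in> V" using x(1) v(1) by auto
    ultimately show ?case by blast
  qed
  from this[of n] obtain x where x: "\<forall>i<n. x i \<in> V" and ind: "Findep (\<lambda>c. c) x n" by auto
  have "lin (\<lambda>c. c) x m v \<in> V" if "m \<le> n" "\<And>i. i < m \<Longrightarrow> v i \<in> K" for m v
    using that by (induction m) (use zero add scale x in \<open>auto simp: lin_def\<close>)
  then have "Fspan (\<lambda>c. c) x n \<subseteq> V" by (auto elim!: FspanE)
  then have span_V: "Fspan (\<lambda>c. c) x n = V"
    using fin V card_Fspan[OF id ind] by (intro card_subset_eq) auto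
  have "vanishing (\<lambda>c. c) x n = additive_poly n g"
  proof (rule poly_eqI_degree_lead_coeff[where n = "q ^ n" and A = V])
    have deg: "Polynomial.degree (vanishing (\<lambda>c. c) x n) = q ^ n"
      unfolding vanishing_def span_V by (subst degree_prod_eq_sum_degree) (auto simp: V)
    have "Polynomial.lead_coeff (vanishing (\<lambda>c. c) x n) = 1"
      unfolding vanishing_def by (simp add: Polynomial.lead_coeff_prod)
    then show "poly.coeff (vanishing (\<lambda>c. c) x n) (q ^ n) = poly.coeff ?G (q ^ n)"
      by (simp add: deg coeff_additive_poly assms(1))
    show "Polynomial.degree (vanishing (\<lambda>c. c) x n) \<le> q ^ n" by (simp add: deg)
    show "Polynomial.degree ?G \<le> q ^ n" by (simp add: degree_additive_poly[of g n, OF assms(1)])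
    fix z assume z: "z \<in> V"
    have "poly (vanishing (\<lambda>c. c) x n) z = 0"
      unfolding vanishing_def poly_prod span_V
      by (rule prod_zero[OF fin bexI[of _ "- z"]]) (use diff[OF zero z] in auto)
    then show "poly (vanishing (\<lambda>c. c) x n) z = poly ?G z" using z by (simp add: V_def)
  qed (simp add: V)
  with ind that show thesis by blast
qed

end

section \<open>Descent along the tower of subalgebras\<close>

definition coeffs_in :: "'a::comm_ring_1 set \<Rightarrow> 'a poly \<Rightarrow> bool" where
  "coeffs_in T p \<longleftrightarrow> (\<forall>i. poly.coeff p i \<in> T)"

context
  fixes T :: "'a::comm_ring_1 set"
  assumes T: "is_subring T"
begin

lemma coeffs_in_pCons: "coeffs_in T (pCons a p) \<longleftrightarrow> a \<in> T \<and> coeffs_in T p"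
  unfolding coeffs_in_def by (metis coeff_pCons_0 coeff_pCons_Suc not0_implies_Suc)

lemma coeffs_in_closed:
  "coeffs_in T 0" "coeffs_in T 1" "coeffs_in T p \<Longrightarrow> coeffs_in T r \<Longrightarrow> coeffs_in T (p + r)"
  "coeffs_in T p \<Longrightarrow> coeffs_in T r \<Longrightarrow> coeffs_in T (p - r)"
  "coeffs_in T p \<Longrightarrow> coeffs_in T r \<Longrightarrow> coeffs_in T (p * r)"
  "coeffs_in T p \<Longrightarrow> a \<in> T \<Longrightarrow> coeffs_in T (Polynomial.smult a p)"
  by (auto simp: coeffs_in_def coeff_mult intro: is_subringD[OF T])

lemma coeffs_in_prod: "(\<And>x. x \<in> A \<Longrightarrow> coeffs_in T (F x)) \<Longrightarrow> coeffs_in T (prod F A)"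
  by (induction A rule: infinite_finite_induct) (auto intro: coeffs_in_closed)

text \<open>As p is monic, the coefficient of p * r in degree \<open>degree p + i\<close> isolates
  that of r in degree i, up to products with higher coefficients of r. Hence the induction runs down
  from the degree of r.\<close>

lemma coeffs_in_quotient:
  assumes "coeffs_in T p" "Polynomial.lead_coeff p = 1" "coeffs_in T (p * r)"
  shows "coeffs_in T r"
proof -
  let ?d = "Polynomial.degree p"
  have "poly.coeff r i \<in> T" for i
  proof (induction "Polynomial.degree r - i" arbitrary: i rule: less_induct)
    case less
    show ?case
    proof (cases "i \<le> Polynomial.degree r")
      case True
      have "poly.coeff (p * r) (?d + i) = (\<Sum>j\<le>?d + i. poly.coeff p j * poly.coeff r (?d + i - j))"
        by (simp add: coeff_mult)
      also have "\<dots> = (\<Sum>j\<in>{..<?d} \<union> {?d}. poly.coeff p j * poly.coeff r (?d + i - j))"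
        by (rule sum.mono_neutral_right) (auto simp: coeff_eq_0)
      also have "\<dots> = (\<Sum>j<?d. poly.coeff p j * poly.coeff r (?d + i - j)) + poly.coeff r i"
        using assms(2) by (subst sum.union_disjoint) auto
      finally have "poly.coeff r i = poly.coeff (p * r) (?d + i)
          - (\<Sum>j<?d. poly.coeff p j * poly.coeff r (?d + i - j))" by simp
      moreover have "poly.coeff r (?d + i - j) \<in> T" if "j < ?d" for j
      proof (cases "?d + i - j \<le> Polynomial.degree r")
        case True
        then show ?thesis using that \<open>i \<le> _\<close> by (intro less) auto
      qed (auto simp: coeff_eq_0 intro: is_subringD[OF T])
      ultimately show ?thesis
        using assms(1,3) by (auto simp: coeffs_in_def intro!: is_subringD[OF T])
    qed (auto simp: coeff_eq_0 intro: is_subringD[OF T])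
  qed
  then show ?thesis by (simp add: coeffs_in_def)
qed

text \<open>Division with remainder by Horner's scheme: only the value at x is tracked, and all
  coefficients stay in T.\<close>

lemma reduce_mod_monic_root:
  assumes H: "coeffs_in T H" "Polynomial.lead_coeff H = 1" "Polynomial.degree H > 0" "poly H x = 0"
    and p: "coeffs_in T p"
  obtains r where "coeffs_in T r" "Polynomial.degree r < Polynomial.degree H" "poly r x = poly p x"
proof -
  have "\<exists>r. coeffs_in T r \<and> Polynomial.degree r < Polynomial.degree H \<and> poly r x = poly p x"
    using p
  proof (induction p)
    case 0
    show ?case by (rule exI[of _ 0]) (use H(3) in \<open>auto intro: coeffs_in_closed\<close>)
  next
    case (pCons a p)
    then have a: "a \<in> T" and "coeffs_in T p" by (simp_all add: coeffs_in_pCons)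
    with pCons.IH obtain r where
      r: "coeffs_in T r" "Polynomial.degree r < Polynomial.degree H" "poly r x = poly p x" by auto
    define N where "N = Polynomial.degree H"
    \<comment> \<open>Multiplication by X can raise the degree to N. The coefficient that reaches
      X^N is removed by a multiple of the monic H, which leaves the value at the root x
      unchanged.\<close>
    define r' where "r' = pCons a r - Polynomial.smult (poly.coeff r (N - 1)) H"
    have "coeffs_in T r'"
      unfolding r'_def using r(1) a H(1)
      by (intro coeffs_in_closed) (simp_all add: coeffs_in_pCons, simp add: coeffs_in_def)
    moreover have "Polynomial.degree r' < N"
    proof -
      have "poly.coeff r' i = 0" if "i > N - 1" for i
      proof (cases "i = N")
        case True
        then show ?thesis using H(2,3) by (cases N) (auto simp: r'_def N_def coeff_pCons split: nat.splits)
      next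
        case False
        then have "i > N" using that by simp
        then show ?thesis using r(2)
          by (cases i) (auto simp: r'_def N_def coeff_pCons coeff_eq_0)
      qed
      then have "Polynomial.degree r' \<le> N - 1" by (intro degree_le) auto
      then show ?thesis using H(3) by (simp add: N_def)
    qed
    moreover have "poly r' x = poly (pCons a p) x"
      by (simp add: r'_def H(4) r(3))
    ultimately show ?case by (auto simp: N_def)
  qed
  with that show thesis by blast
qed

end

text \<open>The bound on the number of roots, modulo an f that need not be prime. Splitting off X -
  l by synthetic division leaves a quotient that vanishes modulo f at the other points, since the
  differences can be cancelled.\<close>

lemma dvd_coeff_of_roots:
  fixes f :: "'a::comm_ring_1"
  assumes "finite L" "\<And>l l' a. l \<in> L \<Longrightarrow> l' \<in> L \<Longrightarrow> l \<noteq> l' \<Longrightarrow> f dvd (l - l') * a \<Longrightarrow> f dvd a"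
    "Polynomial.degree p < card L" "\<And>l. l \<in> L \<Longrightarrow> f dvd poly p l"
  shows "f dvd poly.coeff p i"
  using assms
proof (induction L arbitrary: p i rule: finite_induct)
  case (insert l L)
  define r where "r = synthetic_div p l"
  have p: "p = [:- l, 1:] * r + [:poly p l:]"
    unfolding r_def by (rule synthetic_div_correct'[symmetric])
  have l: "f dvd poly p l" by (rule insert.prems(3)) simp
  \<comment> \<open>Degree 0 is separate: \<open>L\<close> may then be empty, and the quotient would
    miss the strict degree bound of the induction hypothesis.\<close>
  show ?case
  proof (cases "Polynomial.degree p = 0")
    case True
    then obtain c where "p = [:c:]" by (metis degree_eq_zeroE)
    with l show ?thesis by (simp add: coeff_pCons split: nat.splits)
  next
    case False
    have r: "f dvd poly.coeff r j" for j
    proof (rule insert.IH)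
      show "Polynomial.degree r < card L"
        using insert.prems(2) insert.hyps False by (simp add: r_def degree_synthetic_div)
      fix l' assume l': "l' \<in> L"
      have "poly p l' = (l' - l) * poly r l' + poly p l" by (subst p) (simp add: left_diff_distrib)
      moreover have "f dvd poly p l'" by (rule insert.prems(3)) (use l' in simp)
      ultimately have "f dvd (l' - l) * poly r l'"
        using l by (simp only: dvd_add_left_iff)
      then show "f dvd poly r l'"
        using insert.hyps(2) l' by (intro insert.prems(1)[of l' l "poly r l'"]) auto
    next
      fix u u' a assume "u \<in> L" "u' \<in> L" "u \<noteq> u'" "f dvd (u - u') * a"
      then show "f dvd a" by (intro insert.prems(1)[of u u' a] insertI2)
    qed
    have "poly.coeff p i = poly.coeff (pCons 0 r) i - l * poly.coeff r i + poly.coeff [:poly p l:] i"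
      by (subst p) simp
    then show ?thesis using r l by (auto simp: coeff_pCons split: nat.splits)
  qed
next
  case empty
  from empty.prems(2) show ?case by (simp only: card.empty not_less_zero)
qed

section \<open>Dickson invariants and linear forms modulo the relation\<close>

context finite_subfield
begin

text \<open>At the point whose only nonzero coordinate is the m-th, \<open>Var m\<close> has value 1
  and every combination of earlier variables has value 0.\<close>

lemma Findep_Var: "Findep (Const :: 'k \<Rightarrow> 'k mpol) Var n"
  unfolding Findep_def
proof (intro allI impI notI)
  fix m assume "(Var m :: 'k mpol) \<in> Fspan Const Var m"
  then obtain v :: "nat \<Rightarrow> 'k" where v: "Var m = lin Const Var m v" by (elim FspanE)
  define \<epsilon> where "\<epsilon> = peval (\<lambda>c::'k. c) (\<lambda>i. if i = m then 1 else 0)"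
  note id = comm_ring_hom_id[where 'a = 'k]
  interpret comm_ring_hom \<epsilon> unfolding \<epsilon>_def by (rule peval_comm_ring_hom[OF id])
  have "\<epsilon> (Var m) = 1" by (simp add: \<epsilon>_def peval_Var[OF id])
  moreover have "\<epsilon> (lin Const Var m v) = 0"
    unfolding lin_def hom_sum hom_mult by (rule sum.neutral) (simp add: \<epsilon>_def peval_Var[OF id])
  ultimately show False using v by simp
qed

abbreviation W :: "nat \<Rightarrow> 'k mpol set" where "W m \<equiv> Fspan Const Var m"

lemmas Const_hom = Const_comm_ring_hom[where 'k = 'k]

lemma CHAR_mpol_p: "CHAR('k mpol) = p"
  by (simp add: CHAR_mpol CHAR_k)

text \<open>The products over coefficient vectors and over forms agree because distinct vectors give
  distinct forms.\<close>

lemma dickson_poly_eq: "(dickson_poly q n :: 'k mpol poly) = vanishing Const Var n"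
  unfolding dickson_poly_def vanishing_def
  by (simp add: prod_lin_eq_prod_Fspan[OF Const_hom Findep_Var, symmetric] lin_def)

lemma degree_dickson_poly: "Polynomial.degree (dickson_poly q n :: 'k mpol poly) = q ^ n"
  unfolding dickson_poly_eq vanishing_def
  by (subst degree_prod_eq_sum_degree) (auto simp: card_Fspan[OF Const_hom Findep_Var])

lemma lead_coeff_dickson_poly: "Polynomial.lead_coeff (dickson_poly q n :: 'k mpol poly) = 1"
  unfolding dickson_poly_eq vanishing_def by (simp add: Polynomial.lead_coeff_prod)

lemma dickson_n: "dickson q n n = (1 :: 'k mpol)"
  using lead_coeff_dickson_poly[of n] by (simp add: dickson_def degree_dickson_poly)

lemma dickson_0: "dickson q n 0 = ((- 1) ^ n * moore_det q n ^ (q - 1) :: 'k mpol)"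
  using coeff_vanishing_1[OF Const_hom CHAR_mpol_p Findep_Var]
  by (simp add: dickson_def dickson_poly_eq moore_det_eq)

lemma coeff_dickson_poly_eq_0:
  "(\<And>j. j \<le> n \<Longrightarrow> k \<noteq> q ^ j) \<Longrightarrow> poly.coeff (dickson_poly q n :: 'k mpol poly) k = 0"
  unfolding dickson_poly_eq by (rule coeff_vanishing_eq_0[OF Const_hom CHAR_mpol_p Findep_Var])

definition rel :: "nat \<Rightarrow> 'k mpol" where "rel n = moore_det q n ^ (q - 1) - 1"

text \<open>Through this expression \<open>rel n\<close> inherits invariance and membership in the
  polynomial ring from a Dickson invariant.\<close>

lemma rel_eq: "rel n = (- 1) ^ n * dickson q n 0 - 1"
  by (simp add: rel_def dickson_0 mult.assoc[symmetric] power_mult_distrib[symmetric])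

lemma dickson_0_eq: "dickson q n 0 = (- 1) ^ n * (rel n + 1)"
  by (simp add: rel_def dickson_0)

text \<open>A nonzero linear form divides \<open>dickson q n 0\<close>, which is a unit modulo \<open>rel n\<close>.\<close>

lemma rel_dvd_cancel:
  assumes "w \<in> W n" "w \<noteq> 0" "rel n dvd w * a"
  shows "rel n dvd a"
proof -
  have 0: "(0 :: 'k mpol) \<in> W n"
    using Fspan_diff[OF Const_hom assms(1) assms(1)] by simp
  \<comment> \<open>The form 0 contributes the factor X, so the coefficient of X is the constant
    term of the remaining product, the product of all nonzero forms.\<close>
  have "vanishing Const Var n = [:0, 1:] * (\<Prod>w\<in>W n - {0}. [:w, 1:])"
    unfolding vanishing_def by (subst prod.remove[OF finite_Fspan 0]) simp
  then have "dickson q n 0 = poly (\<Prod>w\<in>W n - {0}. [:w, 1:]) 0"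
    by (simp add: dickson_def dickson_poly_eq poly_0_coeff_0)
  also have "\<dots> = \<Prod>(W n - {0})" by (simp add: poly_prod)
  also have "\<dots> = w * \<Prod>(W n - {0} - {w})"
    using assms finite_Fspan by (subst prod.remove[of _ w]) auto
  finally have "rel n dvd dickson q n 0 * a"
    using dvd_mult2[OF assms(3), of "\<Prod>(W n - {0} - {w})"] by (simp add: mult_ac)
  then have "rel n dvd (- 1) ^ n * ((- 1) ^ n * (rel n + 1) * a)"
    unfolding dickson_0_eq by (rule dvd_mult)
  moreover have "(- 1) ^ n * ((- 1) ^ n * (rel n + 1) * a) = rel n * a + a"
  proof -
    have "(- 1) ^ n * (- 1) ^ n = (1 :: 'k mpol)" by (simp flip: power_mult_distrib)
    then show ?thesis by (simp only: mult.assoc[symmetric]) (simp add: distrib_right)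
  qed
  ultimately show ?thesis by (metis dvd_add_right_iff dvd_triv_left)
qed

end

lemma gen_alg_insert_rep:
  assumes "h \<in> gen_alg (insert y Y)"
  obtains r where "coeffs_in (gen_alg Y) r" "poly r y = h"
proof -
  note T = is_subring_gen_alg[of Y]
  have "\<exists>r. coeffs_in (gen_alg Y) r \<and> poly r y = h"
    using assms
  proof induction
    case (Const c)
    show ?case
      by (rule exI[of _ "[:Const c:]"])
        (simp add: coeffs_in_pCons[OF T] coeffs_in_closed[OF T] gen_alg.Const)
  next
    case (gen z)
    show ?case
    proof (cases "z = y")
      case True
      then show ?thesis
        by (intro exI[of _ "[:0, 1:]"])
          (simp add: coeffs_in_pCons[OF T] coeffs_in_closed[OF T] is_subringD[OF T])
    next
      case False
      with gen show ?thesis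
        by (intro exI[of _ "[:z:]"])
          (simp add: coeffs_in_pCons[OF T] coeffs_in_closed[OF T] gen_alg.gen)
    qed
  next
    case (add a b)
    then show ?case by (metis coeffs_in_closed(3)[OF T] poly_add)
  next
    case (mult a b)
    then show ?case by (metis coeffs_in_closed(5)[OF T] poly_mult)
  qed
  with that show thesis by blast
qed

section \<open>The action of the general linear group on forms and invariants\<close>

context finite_subfield
begin

lemma GL_act_eq: "GL_act n (g :: 'k mat) = peval Const (\<lambda>i. lin Const Var n (\<lambda>j. g $$ (j, i)))"
  by (simp add: GL_act_def poly_subst_eq_peval lin_def)

lemma GL_act_hom: "comm_ring_hom (GL_act n (g :: 'k mat))"
  unfolding GL_act_eq by (rule peval_comm_ring_hom[OF Const_hom])

lemma GL_act_Const: "GL_act n (g :: 'k mat) (Const c) = Const c"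
  unfolding GL_act_eq by (rule peval_Const[OF Const_hom])

lemma GL_act_Var: "GL_act n (g :: 'k mat) (Var i) = lin Const Var n (\<lambda>j. g $$ (j, i))"
  unfolding GL_act_eq by (rule peval_Var[OF Const_hom])

lemma GL_act_lin:
  "GL_act n (g :: 'k mat) (lin Const Var m v) = lin Const Var n (\<lambda>j. \<Sum>i<m. g $$ (j, i) * v i)"
proof -
  interpret G: comm_ring_hom "GL_act n g" by (rule GL_act_hom)
  interpret C: comm_ring_hom "Const :: 'k \<Rightarrow> 'k mpol" by (rule Const_hom)
  have "GL_act n g (lin Const Var m v) = (\<Sum>i<m. Const (v i) * (\<Sum>j<n. Const (g $$ (j, i)) * Var j))"
    by (simp add: lin_def G.hom_sum G.hom_mult GL_act_Const GL_act_Var[unfolded lin_def])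
  also have "\<dots> = (\<Sum>i<m. \<Sum>j<n. Const (g $$ (j, i) * v i) * Var j)"
    by (simp add: sum_distrib_left C.hom_mult mult_ac)
  also have "\<dots> = lin Const Var n (\<lambda>j. \<Sum>i<m. g $$ (j, i) * v i)"
    by (subst sum.swap) (simp add: lin_def C.hom_sum sum_distrib_right)
  finally show ?thesis .
qed

lemma GL_entry: "g \<in> GL q n \<Longrightarrow> i < n \<Longrightarrow> j < n \<Longrightarrow> g $$ (i, j) \<in> (K :: 'k set)"
  by (fastforce simp: GL_def elements_mat_def)

lemma GL_inverse:
  assumes "g \<in> (GL q n :: 'k mat set)"
  obtains h where "h \<in> GL q n" "g * h = 1\<^sub>m n" "h * g = 1\<^sub>m n"
  using assms by (auto simp: GL_def)

lemma GL_act_W: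
  assumes "g \<in> GL q n" "w \<in> W n"
  shows "GL_act n g w \<in> W n"
  using assms(2)
  by (elim FspanE) (auto simp: GL_act_lin intro!: lin_in_Fspan K_sum K_closed GL_entry[OF assms(1)])

lemma GL_act_inverse:
  assumes "g \<in> GL q n" "h \<in> GL q n" "h * g = 1\<^sub>m n" "w \<in> W n"
  shows "GL_act n h (GL_act n g w) = w"
proof -
  from assms(4) obtain v where w: "w = lin Const Var n v" by (elim FspanE)
  have dims: "g \<in> carrier_mat n n" "h \<in> carrier_mat n n" using assms by (auto simp: GL_def)
  have "(\<Sum>j<n. h $$ (k, j) * (\<Sum>i<n. g $$ (j, i) * v i)) = v k" if k: "k < n" for k
  proof -
    have "(\<Sum>j<n. h $$ (k, j) * (\<Sum>i<n. g $$ (j, i) * v i))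
        = (\<Sum>i<n. (\<Sum>j<n. h $$ (k, j) * g $$ (j, i)) * v i)"
      by (simp add: sum_distrib_left sum_distrib_right mult.assoc) (rule sum.swap)
    also have "\<dots> = (\<Sum>i<n. (h * g) $$ (k, i) * v i)"
      using dims k by (intro sum.cong) (auto simp: scalar_prod_def atLeast0LessThan)
    also have "\<dots> = (\<Sum>i<n. if i = k then v i else 0)"
      unfolding assms(3) using k by (intro sum.cong) auto
    finally show ?thesis using k by simp
  qed
  then show ?thesis by (auto simp: w GL_act_lin intro: lin_cong)
qed

lemma GL_act_bij_W:
  assumes "g \<in> GL q n"
  shows "bij_betw (GL_act n g) (W n) (W n)"
proof -
  obtain h where h: "h \<in> GL q n" "g * h = 1\<^sub>m n" "h * g = 1\<^sub>m n" by (rule GL_inverse[OF assms])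
  show ?thesis
    using assms h by (intro bij_betwI[of _ _ _ "GL_act n h"]) (auto intro: GL_act_W GL_act_inverse)
qed

text \<open>An invertible g permutes the linear forms, hence the factors of the Dickson polynomial,
  and so fixes its coefficients.\<close>

lemma GL_act_dickson:
  assumes "g \<in> GL q n"
  shows "GL_act n g (dickson q n i) = (dickson q n i :: 'k mpol)"
proof -
  interpret G: comm_ring_hom "GL_act n g" by (rule GL_act_hom)
  interpret GP: map_poly_comm_ring_hom "GL_act n g" ..
  have "map_poly (GL_act n g) (vanishing Const Var n) = (\<Prod>w\<in>W n. [:GL_act n g w, 1:])"
    unfolding vanishing_def by (simp add: GP.hom_prod)
  also have "\<dots> = vanishing Const Var n"
    unfolding vanishing_def
    by (rule prod.reindex_bij_betw[OF GL_act_bij_W[OF assms], of "\<lambda>w. [:w, 1:]"])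
  finally have "poly.coeff (map_poly (GL_act n g) (dickson_poly q n)) (q ^ i)
      = poly.coeff (dickson_poly q n) (q ^ i)" by (simp add: dickson_poly_eq)
  then show ?thesis by (simp add: dickson_def coeff_map_poly)
qed

lemma GL_act_rel: "g \<in> GL q n \<Longrightarrow> GL_act n g (rel n) = rel n"
proof -
  assume g: "g \<in> GL q n"
  interpret G: comm_ring_hom "GL_act n g" by (rule GL_act_hom)
  show ?thesis by (simp add: rel_eq G.hom_minus G.hom_mult G.hom_power G.hom_uminus GL_act_dickson[OF g])
qed

lemma W_mono: "m \<le> n \<Longrightarrow> W m \<subseteq> W n"
proof
  fix w :: "'k mpol" assume "m \<le> n" "w \<in> W m"
  from FspanE[OF \<open>w \<in> W m\<close>] obtain v
    where v: "\<And>i. i < m \<Longrightarrow> v i \<in> K" "w = lin Const Var m v" by blast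
  have "w = lin Const Var n (\<lambda>i. if i < m then v i else 0)"
    unfolding v(2) lin_def using \<open>m \<le> n\<close>
    by (intro sum.mono_neutral_cong_left) (auto simp: Const_def)
  also have "\<dots> \<in> W n" using v(1) by (intro lin_in_Fspan) auto
  finally show "w \<in> W n" .
qed

lemma Var_in_W: "i < n \<Longrightarrow> Var i \<in> W n"
proof -
  assume "i < n"
  then have "Var i = lin Const Var n (\<lambda>j. if j = i then 1 else 0)"
    unfolding lin_def
    by (subst sum.remove[of _ i]) (auto intro!: sum.neutral simp: Const_def)
  also have "\<dots> \<in> W n" by (intro lin_in_Fspan) auto
  finally show ?thesis .
qed

lemma GL_with_column:
  fixes v :: "nat \<Rightarrow> 'k"
  assumes "m \<le> r" "r < n" "v r \<noteq> 0" "\<And>i. i < n \<Longrightarrow> v i \<in> K"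
  obtains g where "g \<in> GL q n" "\<And>i. i < n \<Longrightarrow> g $$ (i, m) = v i"
    "\<And>i j. i < n \<Longrightarrow> j < m \<Longrightarrow> g $$ (i, j) = (if i = j then 1 else 0)"
proof -
  \<comment> \<open>Column \<open>r\<close> takes over the \<open>m\<close>-th unit vector, so that \<open>v r \<noteq> 0\<close> makes \<open>g\<close> invertible.\<close>
  define g where "g = mat n n (\<lambda>(i, j). if j = m then v i else if j = r then (if i = m then 1 else 0)
      else (if i = j then 1 else 0))"
  \<comment> \<open>The inverse of g: column m points to column r of g, which holds the m-th unit
    vector, and column r solves the expansion of v in unit vectors for the r-th one.\<close>
  define h where "h = mat n n (\<lambda>(i, j).
      if j = r then (if i = m then 1 / v r else if i = r then - v m / v r else - v i / v r)
      else if j = m then (if i = r then 1 else 0)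
      else (if i = j then 1 else 0))"
  have dims: "g \<in> carrier_mat n n" "h \<in> carrier_mat n n" by (simp_all add: g_def h_def)
  have gh: "g * h = 1\<^sub>m n"
  proof (rule eq_matI)
    fix i j assume "i < dim_row (1\<^sub>m n :: 'k mat)" "j < dim_col (1\<^sub>m n :: 'k mat)"
    then have ij: "i < n" "j < n" by auto
    have "(g * h) $$ (i, j) = (\<Sum>k<n. g $$ (i, k) * h $$ (k, j))"
      using ij dims by (simp add: scalar_prod_def atLeast0LessThan)
    also have "\<dots> = (if i = j then 1 else 0)"
    proof (cases "j = r")
      case False
      define k0 where "k0 = (if j = m then r else j)"
      have "(\<Sum>k<n. g $$ (i, k) * h $$ (k, j)) = (\<Sum>k<n. if k = k0 then g $$ (i, k) else 0)"
        using ij False by (intro sum.cong) (auto simp: h_def k0_def)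
      also have "\<dots> = g $$ (i, k0)" using ij assms(2) by (simp add: k0_def)
      also have "\<dots> = (if i = j then 1 else 0)"
        using ij False assms(1,2) by (auto simp: g_def k0_def)
      finally show ?thesis .
    next
      case True
      have m: "m < n" using assms by simp
      have "(\<Sum>k<n. g $$ (i, k) * h $$ (k, j))
          = v i / v r + (\<Sum>k\<in>{..<n} - {m}. g $$ (i, k) * h $$ (k, r))"
        using m ij assms(2) True by (subst sum.remove[of _ m]) (auto simp: g_def h_def)
      also have "(\<Sum>k\<in>{..<n} - {m}. g $$ (i, k) * h $$ (k, r))
          = (\<Sum>k\<in>{..<n} - {m}. if k = (if i = m then r else i) then (if i = r then 0 else - v i / v r) else 0)"
        using ij assms m by (intro sum.cong) (auto simp: g_def h_def)
      also have "\<dots> = (if i = r then 0 else - v i / v r)"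
        using ij assms m by (auto simp: sum.delta)
      finally show ?thesis using True assms(3) by simp
    qed
    finally show "(g * h) $$ (i, j) = 1\<^sub>m n $$ (i, j)" using ij by simp
  qed (use dims in auto)
  have K: "elements_mat g \<subseteq> K" "elements_mat h \<subseteq> K"
    using assms by (auto simp: elements_mat_def g_def h_def divide_inverse intro!: K_closed)
  then have "g \<in> GL q n"
    using dims gh mat_mult_left_right_inverse[OF dims gh] by (auto simp: GL_def)
  then show thesis using assms(1,2) by (intro that[of g]) (auto simp: g_def)
qed

text \<open>A form outside \<open>W m\<close> has a nonzero coefficient at some index r >= m, so
  together with the first m variables it extends to a basis of the forms. This supplies the sample
  points of the descent.\<close>

lemma GL_moving_Var:
  assumes "m < n" "l \<in> W n - W m"
  obtains g where "g \<in> GL q n" "GL_act n g (Var m) = l"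
    "\<And>i. i < m \<Longrightarrow> GL_act n g (Var i) = (Var i :: 'k mpol)"
proof -
  from assms(2) obtain v where v: "\<And>i. i < n \<Longrightarrow> v i \<in> K" "l = lin Const Var n v"
    by (auto elim: FspanE)
  have "\<exists>r\<ge>m. r < n \<and> v r \<noteq> 0"
  proof (rule ccontr)
    assume "\<not> ?thesis"
    then have "l = lin Const Var m v"
      unfolding v(2) lin_def using assms(1)
      by (intro sum.mono_neutral_right) (auto simp: Const_def)
    also have "\<dots> \<in> W m" using v(1) assms(1) by (intro lin_in_Fspan) auto
    finally show False using assms(2) by simp
  qed
  then obtain r where r: "m \<le> r" "r < n" "v r \<noteq> 0" by auto
  obtain g where g: "g \<in> GL q n" "\<And>i. i < n \<Longrightarrow> g $$ (i, m) = v i"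
    "\<And>i j. i < n \<Longrightarrow> j < m \<Longrightarrow> g $$ (i, j) = (if i = j then 1 else 0)"
    using GL_with_column[of m r n v, OF r v(1)] by blast
  show thesis
  proof (rule that[OF g(1)])
    show "GL_act n g (Var m) = l" unfolding GL_act_Var v(2) by (intro lin_cong g(2))
    fix i assume i: "i < m"
    have "GL_act n g (Var i) = (\<Sum>j<n. if j = i then Var i else 0)"
      unfolding GL_act_Var lin_def using i g(3) by (intro sum.cong) (auto simp: Const_def)
    then show "GL_act n g (Var i) = (Var i :: 'k mpol)" using i assms(1) by simp
  qed
qed

section \<open>The tower of subalgebras and the descent\<close>

definition tower :: "nat \<Rightarrow> nat \<Rightarrow> 'k mpol set" where
  "tower n m = gen_alg (dickson q n ` {..<n} \<union> Var ` {..<m})"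

lemma is_subring_tower: "is_subring (tower n m)"
  by (simp add: tower_def is_subring_gen_alg)

lemmas tower_closed = is_subringD[OF is_subring_tower]

lemma Const_in_tower: "Const c \<in> tower n m"
  by (simp add: tower_def gen_alg.Const)

lemma W_in_tower: "w \<in> W m \<Longrightarrow> w \<in> tower n m"
proof (elim FspanE)
  fix v :: "nat \<Rightarrow> 'k" assume w: "w = lin Const Var m v"
  have "Var i \<in> tower n m" if "i < m" for i
    unfolding tower_def by (rule gen_alg.gen) (use that in simp)
  then show "w \<in> tower n m"
    unfolding w lin_def by (intro tower_closed(6,8) Const_in_tower) simp
qed

lemma dickson_poly_coeffs_in: "coeffs_in (tower n m) (dickson_poly q n)"
  unfolding coeffs_in_def
proof
  fix k
  show "poly.coeff (dickson_poly q n) k \<in> tower n m"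
  proof (cases "\<exists>j\<le>n. k = q ^ j")
    case True
    then obtain j where j: "j \<le> n" "poly.coeff (dickson_poly q n) k = (dickson q n j :: 'k mpol)"
      by (auto simp: dickson_def)
    show ?thesis
    proof (cases "j = n")
      case True
      then show ?thesis by (simp add: j(2) dickson_n tower_closed)
    next
      case False
      then show ?thesis unfolding j(2) tower_def using j(1) by (intro gen_alg.gen) auto
    qed
  next
    case False
    then have "poly.coeff (dickson_poly q n :: 'k mpol poly) k = 0"
      by (intro coeff_dickson_poly_eq_0) auto
    then show ?thesis by (simp add: tower_closed)
  qed
qed

text \<open>The polynomial H is the quotient of the Dickson polynomial for n by that for m. The
  first has Dickson invariants as coefficients, the second has its roots in \<open>W m\<close>; so
  both lie over \<open>tower n m\<close>, and division by a monic polynomial stays there.\<close>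

lemma tower_Suc_rep:
  assumes "m < n" "h \<in> tower n (Suc m)"
  obtains r where "coeffs_in (tower n m) r" "Polynomial.degree r < q ^ n - q ^ m" "poly r (Var m) = h"
proof -
  note T = is_subring_tower[of n m]
  have "h \<in> gen_alg (insert (Var m) (dickson q n ` {..<n} \<union> Var ` {..<m}))"
    using assms(2) by (simp add: tower_def lessThan_Suc)
  from gen_alg_insert_rep[OF this] obtain p where p: "coeffs_in (tower n m) p" "poly p (Var m) = h"
    unfolding tower_def by blast
  define H :: "'k mpol poly" where "H = (\<Prod>w\<in>W n - W m. [:w, 1:])"
  have Wm: "W m \<subseteq> W n" using assms(1) by (intro W_mono) simp
  have "vanishing Const Var n = vanishing Const Var m * H"
    unfolding vanishing_def H_def using prod.subset_diff[OF Wm finite_Fspan] by (simp add: mult.commute)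
  then have fact: "dickson_poly q n = dickson_poly q m * H" by (simp add: dickson_poly_eq)
  have H: "coeffs_in (tower n m) H"
  proof (rule coeffs_in_quotient[OF T])
    show "coeffs_in (tower n m) (dickson_poly q m)"
      unfolding dickson_poly_eq vanishing_def
      by (intro coeffs_in_prod[OF T]) (simp add: coeffs_in_pCons[OF T] coeffs_in_closed[OF T] W_in_tower tower_closed)
    show "coeffs_in (tower n m) (dickson_poly q m * H)"
      using dickson_poly_coeffs_in[of n m] by (simp add: fact)
  qed (rule lead_coeff_dickson_poly)
  have "card (W n - W m) = q ^ n - q ^ m"
    using Wm by (simp add: card_Diff_subset finite_Fspan card_Fspan[OF Const_hom Findep_Var])
  then have deg: "Polynomial.degree H = q ^ n - q ^ m"
    unfolding H_def by (subst degree_prod_eq_sum_degree) auto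
  have "Var m \<in> W n - W m"
    using Findep_Var[of n] assms(1) Var_in_W[of m n] by (auto simp: Findep_def)
  \<comment> \<open>The factors are X + w, so the one that vanishes at \<open>Var m\<close> belongs
    to w = - \<open>Var m\<close>.\<close>
  then have "- Var m \<in> W n - W m"
    using Fspan_uminus[OF Const_hom, of "Var m" Var n] Fspan_uminus[OF Const_hom, of "- Var m" Var m] by auto
  then have root: "poly H (Var m) = 0"
    unfolding H_def poly_prod by (intro prod_zero bexI[of _ "- Var m"]) (auto simp: finite_Fspan)
  have "Polynomial.degree H > 0" unfolding deg using q_ge_2 assms(1) by simp
  moreover have "Polynomial.lead_coeff H = 1" unfolding H_def by (simp add: Polynomial.lead_coeff_prod)
  ultimately show thesis
    using reduce_mod_monic_root[OF T H _ _ root p(1)] p(2) that by (metis deg)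
qed

text \<open>If \<open>h\<close> is a polynomial \<open>r\<close> of degree less than \<open>q ^ n - q ^ m\<close> in \<open>Var m\<close>, then invariance
  makes \<open>r - h\<close> vanish at all \<open>q ^ n - q ^ m\<close> images of \<open>Var m\<close>, so \<open>h\<close> is the constant
  coefficient of \<open>r\<close> modulo \<open>rel n\<close>.\<close>

lemma descent_step:
  assumes "m < n" "h \<in> tower n (Suc m)" "\<And>g. g \<in> GL q n \<Longrightarrow> rel n dvd GL_act n g h - h"
  obtains h' where "h' \<in> tower n m" "rel n dvd h - h'"
proof -
  obtain r where r: "coeffs_in (tower n m) r" "Polynomial.degree r < q ^ n - q ^ m" "poly r (Var m) = h"
    by (rule tower_Suc_rep[OF assms(1,2)])
  have Wm: "W m \<subseteq> W n" using assms(1) by (intro W_mono) simp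
  have "rel n dvd poly.coeff (r - [:h:]) 0"
  proof (rule dvd_coeff_of_roots)
    show "finite (W n - W m)" by (simp add: finite_Fspan)
    show "Polynomial.degree (r - [:h:]) < card (W n - W m)"
      using Wm r(2) degree_diff_less[OF r(2), of "[:h:]"]
      by (simp add: card_Diff_subset finite_Fspan card_Fspan[OF Const_hom Findep_Var])
    fix l l' a assume "l \<in> W n - W m" "l' \<in> W n - W m" "l \<noteq> l'" "rel n dvd (l - l') * a"
    then show "rel n dvd a"
      by (intro rel_dvd_cancel[of "l - l'" n a] Fspan_diff[OF Const_hom]) simp_all
  next
    fix l assume "l \<in> W n - W m"
    then obtain g where g: "g \<in> GL q n" "GL_act n g (Var m) = l"
      "\<And>i. i < m \<Longrightarrow> GL_act n g (Var i) = (Var i :: 'k mpol)" using GL_moving_Var[OF assms(1)] by blast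
    interpret G: comm_ring_hom "GL_act n g" by (rule GL_act_hom)
    have fixed: "GL_act n g a = a" if "a \<in> tower n m" for a
      by (rule comm_ring_hom_eq_on_gen_alg[OF GL_act_hom comm_ring_hom_id that[unfolded tower_def]])
        (auto simp: GL_act_Const GL_act_dickson[OF g(1)] g(3))
    \<comment> \<open>The coefficients of r are fixed by g, so g only moves the argument.\<close>
    have "GL_act n g (poly r (Var m)) = poly r l"
      using r(1) by (simp add: poly_altdef G.hom_sum G.hom_mult G.hom_power g(2) coeffs_in_def fixed)
    then show "rel n dvd poly (r - [:h:]) l" using assms(3)[OF g(1)] by (simp add: r(3))
  qed
  then have "rel n dvd poly.coeff r 0 - h" by simp
  then have "rel n dvd h - poly.coeff r 0" by (subst dvd_minus_iff[symmetric]) simp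
  moreover have "poly.coeff r 0 \<in> tower n m" using r(1) by (simp add: coeffs_in_def)
  ultimately show thesis by (rule that[rotated])
qed

lemma invariants_mod_rel:
  assumes "h \<in> carrier (mpoly_ring n)" "\<And>g. g \<in> GL q n \<Longrightarrow> rel n dvd GL_act n g h - h"
  obtains h' where "h' \<in> tower n 0" "rel n dvd h - h'"
proof -
  have "\<exists>h'\<in>tower n (n - k). rel n dvd h - h'" if "k \<le> n" for k
    using that
  proof (induction k)
    case 0
    have "h \<in> tower n n"
      using assms(1) unfolding carrier_mpoly_ring
      by (induction h rule: gen_alg.induct) (auto simp: tower_def intro: gen_alg.intros)
    then show ?case by (intro bexI[of _ h]) auto
  next
    case (Suc k)
    then obtain h1 where h1: "h1 \<in> tower n (Suc (n - Suc k))" "rel n dvd h - h1"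
      by (auto simp: Suc_diff_Suc)
    \<comment> \<open>As g fixes \<open>rel n\<close>, it preserves congruences, and invariance
      passes from h to the congruent h1.\<close>
    have "rel n dvd GL_act n g h1 - h1" if g: "g \<in> GL q n" for g
    proof -
      interpret G: comm_ring_hom "GL_act n g" by (rule GL_act_hom)
      obtain u where u: "h - h1 = rel n * u" using h1(2) by (elim dvdE)
      have "GL_act n g (h - h1) = rel n * GL_act n g u"
        unfolding u G.hom_mult GL_act_rel[OF g] ..
      then have "GL_act n g h1 - h1 = (GL_act n g h - h) + (h - h1) - rel n * GL_act n g u"
        by (simp add: G.hom_minus algebra_simps)
      then show ?thesis
        using assms(2)[OF g] h1(2) by (metis dvd_add dvd_diff dvd_triv_left)
    qed
    then obtain h2 where "h2 \<in> tower n (n - Suc k)" "rel n dvd h1 - h2"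
      using descent_step[OF _ h1(1)] Suc.prems by auto
    then show ?case using dvd_add[OF h1(2), of "h1 - h2"] by (intro bexI[of _ h2]) auto
  qed
  from this[of n] show thesis using that by auto
qed

end

section \<open>The ring of invariants\<close>

text \<open>Over a finite field, the product of all X - a increased by 1 would be nonconstant
  without a root.\<close>

lemma infinite_UNIV_alg_closed: "infinite (UNIV :: 'k::alg_closed_field set)"
proof
  assume fin: "finite (UNIV :: 'k set)"
  define f :: "'k poly" where "f = (\<Prod>a\<in>UNIV. [:- a, 1:])"
  have "Polynomial.degree f = CARD('k)"
    unfolding f_def by (subst degree_prod_eq_sum_degree) auto
  then have "Polynomial.degree (f + 1) > 0"
    using finite_UNIV_card_ge_0[OF fin] by (subst degree_add_eq_left) auto
  then obtain z where "poly (f + 1) z = 0" using alg_closed_imp_poly_has_root by blast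
  moreover have "poly f z = 0"
    unfolding f_def poly_prod by (intro prod_zero fin bexI[of _ z]) auto
  ultimately show False by simp
qed

lemma peval_cong_gen_alg:
  assumes "comm_ring_hom \<phi>" "f \<in> carrier (mpoly_ring m)" "\<And>i. i < m \<Longrightarrow> h i = h' i"
  shows "peval \<phi> h f = peval \<phi> h' f"
  using assms(2) unfolding carrier_mpoly_ring
  by (rule comm_ring_hom_eq_on_gen_alg[OF peval_comm_ring_hom[OF assms(1)] peval_comm_ring_hom[OF assms(1)]])
    (auto simp: peval_Const peval_Var assms)

text \<open>Induction on the number of variables: f is read as a polynomial in the last variable,
  and each of its coefficients is shown to vanish at all points.\<close>

lemma mpoly_eq_0_if_vanishing:
  fixes f :: "'k::field mpol"
  assumes "infinite (UNIV :: 'k set)" "f \<in> carrier (mpoly_ring m)"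
    "\<And>\<gamma>. peval (\<lambda>c. c) \<gamma> f = 0"
  shows "f = 0"
proof -
  note id = comm_ring_hom_id[where 'a = 'k]
  interpret C: comm_ring_hom "Const :: 'k \<Rightarrow> 'k mpol" by (rule Const_comm_ring_hom)
  show ?thesis
    using assms(2,3)
  proof (induction m arbitrary: f)
    case 0
    then have "f \<in> gen_alg {}" by (simp add: carrier_mpoly_ring)
    then have "\<exists>c. f = Const c"
    proof induction
      case (add a b)
      then show ?case by (metis C.hom_add)
    next
      case (mult a b)
      then show ?case by (metis C.hom_mult)
    qed auto
    then obtain c where "f = Const c" ..
    with "0.prems"(2)[of undefined] have "c = 0" by (simp add: peval_Const[OF id])
    then show ?case by (simp add: \<open>f = Const c\<close>)
  next
    case (Suc m)
    have "f \<in> gen_alg (insert (Var m) (Var ` {..<m}))"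
      using Suc.prems(1) by (simp add: carrier_mpoly_ring lessThan_Suc)
    then obtain r where r: "coeffs_in (carrier (mpoly_ring m)) r" "poly r (Var m) = f"
      unfolding carrier_mpoly_ring by (rule gen_alg_insert_rep)
    have coeff: "poly.coeff r j \<in> carrier (mpoly_ring m)" for j
      using r(1) by (simp add: coeffs_in_def)
    have "poly.coeff r j = 0" for j
    proof (rule Suc.IH[OF coeff])
      fix \<gamma> :: "nat \<Rightarrow> 'k"
      \<comment> \<open>This is f with the first m coordinates frozen at \<gamma>; every value of
        the last coordinate is a root.\<close>
      define P where "P = (\<Sum>i\<le>Polynomial.degree r. Polynomial.monom (peval (\<lambda>c. c) \<gamma> (poly.coeff r i)) i)"
      have "poly P t = 0" for t
      proof -
        interpret E: comm_ring_hom "peval (\<lambda>c. c) (\<gamma>(m := t))" by (rule peval_comm_ring_hom[OF id])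
        have "poly P t = (\<Sum>i\<le>Polynomial.degree r. peval (\<lambda>c. c) \<gamma> (poly.coeff r i) * t ^ i)"
          by (simp add: P_def poly_sum poly_monom)
        also have "\<dots> = peval (\<lambda>c. c) (\<gamma>(m := t)) f"
          unfolding r(2)[symmetric] poly_altdef E.hom_sum E.hom_mult E.hom_power
          by (intro sum.cong arg_cong2[where f = "(*)"] peval_cong_gen_alg[OF id coeff])
            (auto simp: peval_Var[OF id])
        finally show ?thesis using Suc.prems(2) by simp
      qed
      then have "{t. poly P t = 0} = UNIV" by auto
      then have "P = 0" using assms(1) poly_roots_finite[of P] by auto
      then have "poly.coeff P j = 0" by simp
      then show "peval (\<lambda>c. c) \<gamma> (poly.coeff r j) = 0"
        by (cases "j \<le> Polynomial.degree r") (auto simp: P_def coeff_sum coeff_eq_0 peval_zero[OF id])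
    qed
    then have "r = 0" by (intro poly_eqI) simp
    with r(2) show ?case by simp
  qed
qed

section \<open>The quotient ring and its group action in terms of divisibility\<close>

context finite_subfield
begin

lemma W_in_carrier: "w \<in> W n \<Longrightarrow> w \<in> carrier (mpoly_ring n)"
proof (elim FspanE)
  fix v :: "nat \<Rightarrow> 'k" assume w: "w = lin Const Var n v"
  show "w \<in> carrier (mpoly_ring n)"
    unfolding w lin_def by (intro subring_carrier(6,8) Const_in_carrier Var_in_carrier) simp
qed

lemma dickson_in_carrier: "dickson q n i \<in> carrier (mpoly_ring n :: 'k mpol ring)"
proof -
  note T = is_subring_carrier[of n, where 'a = 'k]
  have "coeffs_in (carrier (mpoly_ring n)) (dickson_poly q n :: 'k mpol poly)"
    unfolding dickson_poly_eq vanishing_def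
    by (intro coeffs_in_prod[OF T])
      (simp add: coeffs_in_pCons[OF T] coeffs_in_closed[OF T] W_in_carrier subring_carrier(1))
  then show ?thesis by (simp add: dickson_def coeffs_in_def)
qed

lemma rel_in_carrier: "rel n \<in> carrier (mpoly_ring n)"
  unfolding rel_eq
  by (intro subring_carrier(1,3,5,6,7) dickson_in_carrier)

text \<open>The ideal is formed inside \<open>mpoly_ring n\<close>, whereas \<open>dvd\<close>
  admits cofactors in further variables. Their agreement lets divisibility replace computation with
  cosets.\<close>

lemma mem_A'_ideal: "f \<in> A'_ideal q n \<longleftrightarrow> f \<in> carrier (mpoly_ring n) \<and> rel n dvd f"
proof -
  interpret R: cring "mpoly_ring n :: 'k mpol ring" by (rule cring_mpoly_ring)
  have "A'_ideal q n = PIdl\<^bsub>mpoly_ring n\<^esub> rel n"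
    using R.cgenideal_eq_genideal[OF rel_in_carrier] by (simp add: A'_ideal_def rel_def)
  then have *: "f \<in> A'_ideal q n \<longleftrightarrow> (\<exists>u\<in>carrier (mpoly_ring n). f = u * rel n)"
    by (auto simp: cgenideal_def)
  show ?thesis
  proof (safe; (subst *)?)
    show "f \<in> carrier (mpoly_ring n)" if "f \<in> A'_ideal q n"
      using that rel_in_carrier by (auto simp: * intro: subring_carrier(6))
    show "rel n dvd f" if "f \<in> A'_ideal q n" using that by (auto simp: *)
    assume f: "f \<in> carrier (mpoly_ring n)" "rel n dvd f"
    then obtain u where u: "f = rel n * u" by (elim dvdE)
    \<comment> \<open>Sending the variables from index n on to 0 fixes f and \<open>rel n\<close>
      and turns the cofactor into a polynomial in the first n variables.\<close>
    define \<pi> where "\<pi> = peval (Const :: 'k \<Rightarrow> 'k mpol) (\<lambda>i. if i < n then Var i else 0)"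
    have hom: "comm_ring_hom \<pi>" unfolding \<pi>_def by (rule peval_comm_ring_hom[OF Const_hom])
    interpret comm_ring_hom \<pi> by (rule hom)
    have \<pi>_fix: "\<pi> h = h" if "h \<in> carrier (mpoly_ring n)" for h
      using peval_cong_gen_alg[OF Const_hom that, of "\<lambda>i. if i < n then Var i else 0" Var]
      by (simp add: \<pi>_def peval_Const_Var)
    have "\<pi> u \<in> carrier (mpoly_ring n)"
      unfolding \<pi>_def peval_def mexp_def
      by (intro subring_carrier(6,7,8,9) Const_in_carrier) (auto intro: Var_in_carrier subring_carrier(2))
    moreover have "f = \<pi> u * rel n"
      using \<pi>_fix[OF f(1)] \<pi>_fix[OF rel_in_carrier] unfolding u hom_mult by (metis mult.commute)
    ultimately show "\<exists>u\<in>carrier (mpoly_ring n). f = u * rel n" by blast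
  qed
qed

lemma ideal_A'_ideal: "ideal (A'_ideal q n) (mpoly_ring n :: 'k mpol ring)"
proof -
  interpret R: cring "mpoly_ring n :: 'k mpol ring" by (rule cring_mpoly_ring)
  show ?thesis
    unfolding A'_ideal_def using rel_in_carrier by (intro R.genideal_ideal) (simp add: rel_def)
qed

lemma A'_class_eq:
  fixes f :: "'k mpol"
  assumes "f \<in> carrier (mpoly_ring n)"
  shows "A'_class q n f = {h \<in> carrier (mpoly_ring n). rel n dvd h - f}"
proof -
  have "A'_class q n f = (\<lambda>i. i + f) ` A'_ideal q n"
    by (auto simp: A'_class_def a_r_coset_def r_coset_def)
  also have "\<dots> = {h \<in> carrier (mpoly_ring n). rel n dvd h - f}"
    using assms by (force simp: mem_A'_ideal intro: subring_carrier(4,5) image_eqI[of _ _ "_ - f"])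
  finally show ?thesis .
qed

lemma A'_class_eq_iff:
  fixes f h :: "'k mpol"
  assumes "f \<in> carrier (mpoly_ring n)" "h \<in> carrier (mpoly_ring n)"
  shows "A'_class q n f = A'_class q n h \<longleftrightarrow> rel n dvd f - h"
proof
  assume "A'_class q n f = A'_class q n h"
  moreover have "f \<in> A'_class q n f" using assms by (simp add: A'_class_eq)
  ultimately show "rel n dvd f - h" using assms by (simp add: A'_class_eq)
next
  assume d: "rel n dvd f - h"
  have "rel n dvd a - f \<longleftrightarrow> rel n dvd a - h" for a
    using dvd_add_left_iff[OF d, of "a - f"] by simp
  then show "A'_class q n f = A'_class q n h" using assms by (simp add: A'_class_eq)
qed

lemma A'_class_ring_hom: "A'_class q n \<in> Ring.ring_hom (mpoly_ring n :: 'k mpol ring) (A' q n)"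
  using ideal.rcos_ring_hom[OF ideal_A'_ideal] by (simp add: A'_def A'_class_def[abs_def])

lemma carrier_A': "carrier (A' q n :: 'k mpol set ring) = A'_class q n ` carrier (mpoly_ring n)"
  by (auto simp: A'_def A'_class_def FactRing_def A_RCOSETS_def')

lemma GL_act_carrier:
  assumes "g \<in> GL q n" "f \<in> carrier (mpoly_ring n)"
  shows "GL_act n g f \<in> carrier (mpoly_ring n :: 'k mpol ring)"
  by (rule comm_ring_hom_image_gen_alg[OF GL_act_hom is_subring_carrier assms(2)[unfolded carrier_mpoly_ring]])
    (auto simp: GL_act_Const Const_in_carrier intro!: W_in_carrier GL_act_W[OF assms(1)] Var_in_W)

lemma GL_act_inverse_carrier:
  assumes "g \<in> GL q n" "h \<in> GL q n" "h * g = 1\<^sub>m n" "f \<in> carrier (mpoly_ring n)"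
  shows "GL_act n h (GL_act n g f) = (f :: 'k mpol)"
  using assms(4) unfolding carrier_mpoly_ring
  by (rule comm_ring_hom_eq_on_gen_alg[OF comm_ring_hom_compose[OF GL_act_hom GL_act_hom] comm_ring_hom_id])
    (auto simp: GL_act_Const GL_act_inverse[OF assms(1-3) Var_in_W])

lemma rel_dvd_GL_act:
  assumes "g \<in> GL q n" "rel n dvd f"
  shows "rel n dvd GL_act n g f"
proof -
  interpret G: comm_ring_hom "GL_act n g" by (rule GL_act_hom)
  from assms(2) obtain u where "f = rel n * u" by (elim dvdE)
  then show ?thesis by (simp add: G.hom_mult GL_act_rel[OF assms(1)])
qed

text \<open>That the image of a coset is a full coset uses the inverse matrix h, which provides the
  preimages.\<close>

lemma A'_act_class:
  fixes f :: "'k mpol"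
  assumes g: "g \<in> GL q n" and f: "f \<in> carrier (mpoly_ring n)"
  shows "A'_act n g (A'_class q n f) = A'_class q n (GL_act n g f)"
proof -
  obtain h where h: "h \<in> GL q n" "g * h = 1\<^sub>m n" "h * g = 1\<^sub>m n" by (rule GL_inverse[OF g])
  interpret G: comm_ring_hom "GL_act n g" by (rule GL_act_hom)
  interpret H: comm_ring_hom "GL_act n h" by (rule GL_act_hom)
  show ?thesis
    unfolding A'_act_def A'_class_eq[OF f] A'_class_eq[OF GL_act_carrier[OF g f]]
  proof (intro equalityI subsetI)
    fix a assume "a \<in> GL_act n g ` {h \<in> carrier (mpoly_ring n). rel n dvd h - f}"
    then obtain b where b: "b \<in> carrier (mpoly_ring n)" "rel n dvd b - f" "a = GL_act n g b" by auto
    then show "a \<in> {h \<in> carrier (mpoly_ring n). rel n dvd h - GL_act n g f}"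
      using GL_act_carrier[OF g b(1)] rel_dvd_GL_act[OF g b(2)] by (simp add: G.hom_minus)
  next
    fix a assume "a \<in> {h \<in> carrier (mpoly_ring n). rel n dvd h - GL_act n g f}"
    then have a: "a \<in> carrier (mpoly_ring n)" "rel n dvd a - GL_act n g f" by auto
    have "rel n dvd GL_act n h a - f"
      using rel_dvd_GL_act[OF h(1) a(2)] by (simp add: H.hom_minus GL_act_inverse_carrier[OF g h(1,3) f])
    then show "a \<in> GL_act n g ` {h \<in> carrier (mpoly_ring n). rel n dvd h - f}"
      using GL_act_inverse_carrier[OF h(1) g h(2) a(1)] GL_act_carrier[OF h(1) a(1)]
      by (intro image_eqI[of _ _ "GL_act n h a"]) auto
  qed
qed

lemma A'_act_fixed_iff:
  assumes "g \<in> GL q n" "f \<in> carrier (mpoly_ring n)"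
  shows "A'_act n g (A'_class q n f) = A'_class q n f \<longleftrightarrow> rel n dvd GL_act n g f - f"
  by (simp only: A'_act_class[OF assms] A'_class_eq_iff[OF GL_act_carrier[OF assms] assms(2)])

lemma carrier_A'_invariants:
  "carrier (A'_invariants q n :: 'k mpol set ring) =
    {A'_class q n f | f. f \<in> carrier (mpoly_ring n) \<and> (\<forall>g\<in>GL q n. rel n dvd GL_act n g f - f)}"
  using A'_act_fixed_iff by (auto simp: A'_invariants_def invariants_def carrier_A')

text \<open>The invariant of index 0 is congruent to the constant (-1)^n and drops out of the
  generators. Hence variable i stands for the invariant of index i + 1.\<close>

lemma tower_0_rep:
  assumes "h \<in> tower n 0" "n \<ge> 1"
  obtains f where "f \<in> carrier (mpoly_ring (n - 1))"
    "rel n dvd h - poly_subst (\<lambda>i. dickson q n (Suc i)) f"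
proof -
  let ?D = "\<lambda>i. dickson q n (Suc i) :: 'k mpol"
  interpret S: comm_ring_hom "poly_subst ?D"
    unfolding poly_subst_eq_peval by (rule peval_comm_ring_hom[OF Const_hom])
  note S_simps = peval_Const[OF Const_hom] peval_Var[OF Const_hom] poly_subst_eq_peval
  have "\<exists>f\<in>carrier (mpoly_ring (n - 1)). rel n dvd h - poly_subst ?D f"
    using assms(1) unfolding tower_def
  proof induction
    case (Const c)
    show ?case by (rule bexI[of _ "Const c"]) (simp_all add: S_simps Const_in_carrier)
  next
    case (gen y)
    then obtain i where i: "i < n" "y = dickson q n i" by auto
    show ?case
    proof (cases i)
      case 0
      have C: "Const ((- 1) ^ n) = ((- 1) ^ n :: 'k mpol)"
      proof -
        interpret C: comm_ring_hom "Const :: 'k \<Rightarrow> 'k mpol" by (rule Const_hom)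
        show ?thesis by (simp add: C.hom_power C.hom_uminus)
      qed
      have "poly_subst ?D (Const ((- 1) ^ n)) = Const ((- 1) ^ n)" by (simp only: S_simps)
      then have "poly_subst ?D (Const ((- 1) ^ n)) = (- 1) ^ n" unfolding C .
      then have "y - poly_subst ?D (Const ((- 1) ^ n)) = rel n * (- 1) ^ n"
        using i 0 by (simp only: dickson_0_eq) (simp add: algebra_simps)
      then show ?thesis by (intro bexI[of _ "Const ((- 1) ^ n)"]) (simp_all add: Const_in_carrier)
    next
      case (Suc j)
      then show ?thesis using i
        by (intro bexI[of _ "Var j"]) (simp_all add: S_simps Var_in_carrier)
    qed
  next
    case (add a b)
    then obtain f f' where f: "f \<in> carrier (mpoly_ring (n - 1))" "rel n dvd a - poly_subst ?D f"
      "f' \<in> carrier (mpoly_ring (n - 1))" "rel n dvd b - poly_subst ?D f'" by auto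
    have "a + b - poly_subst ?D (f + f') = (a - poly_subst ?D f) + (b - poly_subst ?D f')"
      by (simp add: S.hom_add)
    then show ?case using f
      by (intro bexI[of _ "f + f'"]) (simp_all only: dvd_add subring_carrier(4))
  next
    case (mult a b)
    then obtain f f' where f: "f \<in> carrier (mpoly_ring (n - 1))" "rel n dvd a - poly_subst ?D f"
      "f' \<in> carrier (mpoly_ring (n - 1))" "rel n dvd b - poly_subst ?D f'" by auto
    have "a * b - poly_subst ?D (f * f')
        = (a - poly_subst ?D f) * b + poly_subst ?D f * (b - poly_subst ?D f')"
      by (simp add: S.hom_mult algebra_simps)
    then show ?case using f
      by (intro bexI[of _ "f * f'"]) (simp_all only: dvd_add dvd_mult dvd_mult2 subring_carrier(6))
  qed
  with that show thesis by blast
qed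

end

section \<open>Algebraic independence and the isomorphism of algebras\<close>

context finite_subfield_alg_closed
begin

text \<open>At a point with independent coordinates the Dickson polynomial specialises to the
  vanishing polynomial of their span, so prescribing the invariants means realising a given additive
  polynomial in this way.\<close>

lemma dickson_point:
  fixes \<gamma> :: "nat \<Rightarrow> 'k"
  assumes "n \<ge> 1"
  obtains x where "peval (\<lambda>c. c) x (rel n) = 0"
    "\<And>i. i < n - 1 \<Longrightarrow> peval (\<lambda>c. c) x (dickson q n (Suc i)) = \<gamma> i"
proof -
  note id = comm_ring_hom_id[where 'a = 'k]
  \<comment> \<open>The value at 0 is the one that the vanishing of \<open>rel n\<close> forces on
    the invariant of index 0; being nonzero, it also makes the polynomial separable. The value at n
    makes it monic.\<close>
  define g where "g = (\<lambda>i. if i = 0 then (- 1) ^ n else if i = n then 1 else \<gamma> (i - 1))"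
  have "g n = 1" "g 0 \<noteq> 0" using assms by (auto simp: g_def)
  then obtain x where x: "Findep (\<lambda>c. c) x n" "vanishing (\<lambda>c. c) x n = additive_poly n g"
    by (rule additive_poly_eq_vanishing)
  interpret E: comm_ring_hom "peval (\<lambda>c. c) x" by (rule peval_comm_ring_hom[OF id])
  interpret EP: map_poly_comm_ring_hom "peval (\<lambda>c. c) x" ..
  have lin: "peval (\<lambda>c. c) x (lin Const Var n v) = lin (\<lambda>c. c) x n v" for v
    by (simp add: lin_def E.hom_sum E.hom_mult peval_Const[OF id] peval_Var[OF id])
  have "map_poly (peval (\<lambda>c. c) x) (dickson_poly q n)
      = (\<Prod>v\<in>{..<n} \<rightarrow>\<^sub>E K. [:lin (\<lambda>c. c) x n v, 1:])"
    unfolding dickson_poly_def lin_def[symmetric] by (simp add: EP.hom_prod lin)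
  also have "\<dots> = additive_poly n g"
    unfolding x(2)[symmetric] vanishing_def
    by (rule prod_lin_eq_prod_Fspan[OF id x(1), of "\<lambda>w. [:w, 1:]"])
  finally have *: "peval (\<lambda>c. c) x (dickson q n i) = g i" if "i \<le> n" for i
    unfolding dickson_def using coeff_additive_poly[OF that, of g] by (metis E.coeff_map_poly_hom)
  show thesis
  proof
    show "peval (\<lambda>c. c) x (rel n) = 0"
      unfolding rel_eq
      by (simp add: E.hom_minus E.hom_mult E.hom_power E.hom_uminus * g_def flip: power_mult_distrib)
    show "peval (\<lambda>c. c) x (dickson q n (Suc i)) = \<gamma> i" if "i < n - 1" for i
      using that by (simp add: * g_def)
  qed
qed

text \<open>A multiple of \<open>rel n\<close> vanishes at the points from
  \<open>dickson_point\<close>, where the invariants take arbitrary values; so f vanishes at every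
  point of affine space.\<close>

lemma dickson_alg_indep_mod_rel:
  assumes "n \<ge> 1" "f \<in> carrier (mpoly_ring (n - 1))"
    "rel n dvd poly_subst (\<lambda>i. dickson q n (Suc i)) f"
  shows "f = 0"
proof (rule mpoly_eq_0_if_vanishing[OF infinite_UNIV_alg_closed assms(2)])
  note id = comm_ring_hom_id[where 'a = 'k]
  let ?D = "\<lambda>i. dickson q n (Suc i) :: 'k mpol"
  fix \<gamma> :: "nat \<Rightarrow> 'k"
  obtain x where x: "peval (\<lambda>c. c) x (rel n) = 0"
    "\<And>i. i < n - 1 \<Longrightarrow> peval (\<lambda>c. c) x (dickson q n (Suc i)) = \<gamma> i"
    using dickson_point[OF assms(1)] by blast
  have E: "comm_ring_hom (peval (\<lambda>c. c) x)" by (rule peval_comm_ring_hom[OF id])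
  interpret E: comm_ring_hom "peval (\<lambda>c. c) x" by (rule E)
  from assms(3) obtain u where "poly_subst ?D f = rel n * u" by (elim dvdE)
  then have "peval (\<lambda>c. c) x (peval Const ?D f) = 0"
    by (simp add: poly_subst_eq_peval E.hom_mult x(1))
  moreover have "peval (\<lambda>c. c) x (peval Const ?D f) = peval (\<lambda>c. c) \<gamma> f"
    using assms(2) unfolding carrier_mpoly_ring
    by (rule comm_ring_hom_eq_on_gen_alg[OF comm_ring_hom_compose[OF peval_comm_ring_hom[OF Const_hom] E]
          peval_comm_ring_hom[OF id]])
      (auto simp: peval_Const[OF Const_hom] peval_Var[OF Const_hom] peval_Const[OF id] peval_Var[OF id] x(2))
  ultimately show "peval (\<lambda>c. c) \<gamma> f = 0" by simp
qed

text \<open>Injectivity is \<open>dickson_alg_indep_mod_rel\<close> for a difference; surjectivity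
  is the descent followed by \<open>tower_0_rep\<close>.\<close>

proposition A'_invariants_iso:
  assumes n: "n \<ge> 1"
  shows "(\<lambda>f. A'_class q n (poly_subst (\<lambda>i. dickson q n (Suc i)) f))
    \<in> algebra_iso (mpoly_ring (n - 1)) Const (A'_invariants q n) (A'_const q n :: 'k \<Rightarrow> _)"
proof -
  let ?D = "\<lambda>i. dickson q n (Suc i) :: 'k mpol"
  let ?h = "\<lambda>f. A'_class q n (poly_subst ?D f)"
  have hom: "comm_ring_hom (poly_subst ?D)"
    unfolding poly_subst_eq_peval by (rule peval_comm_ring_hom[OF Const_hom])
  interpret S: comm_ring_hom "poly_subst ?D" by (rule hom)
  note S_simps = peval_Const[OF Const_hom] peval_Var[OF Const_hom] poly_subst_eq_peval
  have S: "poly_subst ?D f \<in> carrier (mpoly_ring n)" if "f \<in> carrier (mpoly_ring (n - 1))" for f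
    by (rule comm_ring_hom_image_gen_alg[OF hom is_subring_carrier that[unfolded carrier_mpoly_ring]])
      (auto simp: S_simps Const_in_carrier dickson_in_carrier)
  have inv: "GL_act n g (poly_subst ?D f) = poly_subst ?D f"
    if "f \<in> carrier (mpoly_ring (n - 1))" "g \<in> GL q n" for f g
    by (rule comm_ring_hom_eq_on_gen_alg[OF comm_ring_hom_compose[OF hom GL_act_hom] hom
          that(1)[unfolded carrier_mpoly_ring]])
      (auto simp: S_simps GL_act_Const GL_act_dickson[OF that(2)])
  note cl = ring_hom_memE[OF A'_class_ring_hom[of n]]
  have ops: "mult (A'_invariants q n) = mult (A' q n)" "add (A'_invariants q n) = add (A' q n)"
    "one (A'_invariants q n) = one (A' q n)"
    by (simp_all add: A'_invariants_def invariants_def)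
  have "?h \<in> ring_iso (mpoly_ring (n - 1)) (A'_invariants q n)"
  proof (rule ring_iso_memI)
    fix f f' assume f: "f \<in> carrier (mpoly_ring (n - 1) :: 'k mpol ring)"
    show "?h f \<in> carrier (A'_invariants q n)"
      unfolding carrier_A'_invariants using S[OF f] inv[OF f] by auto
    assume f': "f' \<in> carrier (mpoly_ring (n - 1) :: 'k mpol ring)"
    show "?h (f \<otimes>\<^bsub>mpoly_ring (n - 1)\<^esub> f') = ?h f \<otimes>\<^bsub>A'_invariants q n\<^esub> ?h f'"
      using cl(2)[OF S[OF f] S[OF f']] by (simp add: ops S.hom_mult)
    show "?h (f \<oplus>\<^bsub>mpoly_ring (n - 1)\<^esub> f') = ?h f \<oplus>\<^bsub>A'_invariants q n\<^esub> ?h f'"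
      using cl(3)[OF S[OF f] S[OF f']] by (simp add: ops S.hom_add)
  next
    show "?h \<one>\<^bsub>mpoly_ring (n - 1)\<^esub> = \<one>\<^bsub>A'_invariants q n\<^esub>"
      using cl(4) by (simp add: ops)
    show "bij_betw ?h (carrier (mpoly_ring (n - 1))) (carrier (A'_invariants q n))"
      unfolding bij_betw_def
    proof (intro conjI inj_onI equalityI subsetI)
      fix f f' assume f: "f \<in> carrier (mpoly_ring (n - 1) :: 'k mpol ring)" "f' \<in> carrier (mpoly_ring (n - 1))"
        and "?h f = ?h f'"
      then have "rel n dvd poly_subst ?D (f - f')" by (simp add: A'_class_eq_iff S S.hom_minus)
      then have "f - f' = 0"
        by (intro dickson_alg_indep_mod_rel[OF n]) (simp_all only: subring_carrier(5) f)
      then show "f = f'" by simp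
    next
      fix C assume "C \<in> ?h ` carrier (mpoly_ring (n - 1))"
      then show "C \<in> carrier (A'_invariants q n)"
        unfolding carrier_A'_invariants using S inv by auto
    next
      fix C :: "'k mpol set" assume "C \<in> carrier (A'_invariants q n)"
      then obtain a where a: "C = A'_class q n a" "a \<in> carrier (mpoly_ring n)"
        "\<forall>g\<in>GL q n. rel n dvd GL_act n g a - a" unfolding carrier_A'_invariants by auto
      obtain b where b: "b \<in> tower n 0" "rel n dvd a - b"
        using invariants_mod_rel[OF a(2)] a(3) by blast
      obtain f where f: "f \<in> carrier (mpoly_ring (n - 1))" "rel n dvd b - poly_subst ?D f"
        using tower_0_rep[OF b(1) n] by blast
      have "rel n dvd a - poly_subst ?D f" using dvd_add[OF b(2) f(2)] by simp
      then have "C = ?h f" unfolding a(1) by (simp add: A'_class_eq_iff a(2) S[OF f(1)])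
      with f(1) show "C \<in> ?h ` carrier (mpoly_ring (n - 1))" by blast
    qed
  qed
  then show ?thesis by (simp add: algebra_iso_def S_simps A'_const_def)
qed

end

section \<open>Functoriality of the spectrum\<close>

lemma topspace_zariski: "topspace (zariski_topology R) = {P. primeideal P R}"
proof -
  have "\<exists>a\<in>carrier R. a \<notin> P" if "primeideal P R" for P
    using primeideal.I_notcarr[OF that] ideal.Icarr[OF primeideal.axioms(1)[OF that]] by blast
  then show ?thesis unfolding zariski_topology_def topology_generated_by_topspace by auto
qed

definition contract :: "('r, 'x) ring_scheme \<Rightarrow> ('r \<Rightarrow> 't) \<Rightarrow> 't set \<Rightarrow> 'r set" where
  "contract R h P = {a \<in> carrier R. h a \<in> P}"

text \<open>Fractions are equivalence classes of pairs, and the elementwise image is again a full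
  class when h is an isomorphism, the only case considered below.\<close>

definition frac_map :: "('r \<Rightarrow> 't) \<Rightarrow> ('r \<times> 'r) set \<Rightarrow> ('t \<times> 't) set" where
  "frac_map h C = map_prod h h ` C"

definition spec_preimage ::
  "('r, 'x) ring_scheme \<Rightarrow> ('t, 'y) ring_scheme \<Rightarrow> ('r \<Rightarrow> 't) \<Rightarrow> 'r set set \<Rightarrow> 't set set" where
  "spec_preimage R S h V = {P. primeideal P S \<and> contract R h P \<in> V}"

definition sheaf_map ::
  "('r, 'x) ring_scheme \<Rightarrow> ('t, 'y) ring_scheme \<Rightarrow> ('r \<Rightarrow> 't) \<Rightarrow> 'r set set \<Rightarrow>
    ('r set \<Rightarrow> ('r \<times> 'r) set) \<Rightarrow> 't set \<Rightarrow> ('t \<times> 't) set" where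
  "sheaf_map R S h V \<xi> = (\<lambda>P\<in>spec_preimage R S h V. frac_map h (\<xi> (contract R h P)))"

lemma localization_carrier_subset:
  "C \<in> carrier (localization_at R P) \<Longrightarrow> C \<subseteq> carrier R \<times> carrier R"
  by (auto simp: localization_at_def frac_at_def)

locale cring_iso =
  fixes R :: "('r, 'x) ring_scheme" and S :: "('t, 'y) ring_scheme" and h :: "'r \<Rightarrow> 't"
  assumes cring_R: "cring R" and cring_S: "cring S" and iso: "h \<in> ring_iso R S"
begin

sublocale ring_hom_cring R S h
  using cring_R cring_S iso
  by (auto simp: ring_iso_def intro!: ring_hom_cring.intro ring_hom_cring_axioms.intro)

lemma h_eq_iff: "a \<in> carrier R \<Longrightarrow> b \<in> carrier R \<Longrightarrow> h a = h b \<longleftrightarrow> a = b"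
  using iso by (auto simp: ring_iso_def bij_betw_def inj_on_def)

lemma h_surj: "b \<in> carrier S \<Longrightarrow> \<exists>a\<in>carrier R. b = h a"
  using iso by (auto simp: ring_iso_def bij_betw_def)

lemma primeideal_contract: "primeideal P S \<Longrightarrow> primeideal (contract R h P) R"
  unfolding contract_def
  by (intro ring_hom_ring.primeideal_vimage[OF ring_hom_ringI2[OF R.ring_axioms S.ring_axioms homh]] cring_R)

text \<open>The preimage of the basic open set of a is the basic open set of h a.\<close>

lemma continuous_contract:
  "continuous_map (zariski_topology S) (zariski_topology R) (contract R h)"
  unfolding zariski_topology_def[of R]
proof (rule continuous_on_generated_topo)
  fix U assume "U \<in> (\<lambda>a. {P. primeideal P R \<and> a \<notin> P}) ` carrier R"
  then obtain a where a: "a \<in> carrier R" "U = {P. primeideal P R \<and> a \<notin> P}" by auto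
  have "contract R h -` U \<inter> topspace (zariski_topology S) = {P. primeideal P S \<and> h a \<notin> P}"
    using a primeideal_contract by (auto simp: topspace_zariski contract_def)
  moreover have "openin (zariski_topology S) {P. primeideal P S \<and> h a \<notin> P}"
    unfolding zariski_topology_def using a(1)
    by (intro topology_generated_by_Basis image_eqI[of _ _ "h a"]) auto
  ultimately show "openin (zariski_topology S) (contract R h -` U \<inter> topspace (zariski_topology S))"
    by simp
next
  show "contract R h ` topspace (zariski_topology S)
      \<subseteq> \<Union> ((\<lambda>a. {P. primeideal P R \<and> a \<notin> P}) ` carrier R)"
    using topspace_zariski[of R] primeideal_contract
    by (auto simp: topspace_zariski zariski_topology_def topology_generated_by_topspace)
qed

lemma openin_spec_preimage:
  "openin (zariski_topology R) V \<Longrightarrow> openin (zariski_topology S) (spec_preimage R S h V)"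
  using continuous_contract
  by (auto simp: continuous_map_def topspace_zariski spec_preimage_def)

text \<open>Surjectivity of h provides preimages of numerators, denominators and witnesses;
  injectivity reflects the vanishing that defines equality of fractions.\<close>

lemma frac_map_frac_at:
  assumes "a \<in> carrier R" "s \<in> carrier R"
  shows "frac_map h (frac_at R (contract R h P) a s) = frac_at S P (h a) (h s)"
proof -
  have eq: "h (u \<otimes>\<^bsub>R\<^esub> (a \<otimes>\<^bsub>R\<^esub> t \<ominus>\<^bsub>R\<^esub> b \<otimes>\<^bsub>R\<^esub> s)) = h u \<otimes>\<^bsub>S\<^esub> (h a \<otimes>\<^bsub>S\<^esub> h t \<ominus>\<^bsub>S\<^esub> h b \<otimes>\<^bsub>S\<^esub> h s)"
    if "u \<in> carrier R" "t \<in> carrier R" "b \<in> carrier R" for u t b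
    using that assms by (simp add: a_minus_def)
  have zero: "h u \<otimes>\<^bsub>S\<^esub> (h a \<otimes>\<^bsub>S\<^esub> h t \<ominus>\<^bsub>S\<^esub> h b \<otimes>\<^bsub>S\<^esub> h s) = \<zero>\<^bsub>S\<^esub>
      \<longleftrightarrow> u \<otimes>\<^bsub>R\<^esub> (a \<otimes>\<^bsub>R\<^esub> t \<ominus>\<^bsub>R\<^esub> b \<otimes>\<^bsub>R\<^esub> s) = \<zero>\<^bsub>R\<^esub>"
    if "u \<in> carrier R" "t \<in> carrier R" "b \<in> carrier R" for u t b
    unfolding eq[OF that, symmetric] hom_zero[symmetric] using that assms by (intro h_eq_iff) auto
  show ?thesis
  proof (intro equalityI subsetI)
    fix z assume "z \<in> frac_map h (frac_at R (contract R h P) a s)"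
    then obtain b t u where *: "z = (h b, h t)" "b \<in> carrier R" "t \<in> carrier R" "h t \<notin> P"
      "u \<in> carrier R" "h u \<notin> P" "u \<otimes>\<^bsub>R\<^esub> (a \<otimes>\<^bsub>R\<^esub> t \<ominus>\<^bsub>R\<^esub> b \<otimes>\<^bsub>R\<^esub> s) = \<zero>\<^bsub>R\<^esub>"
      by (auto simp: frac_map_def frac_at_def contract_def)
    then show "z \<in> frac_at S P (h a) (h s)"
      using zero[of u t b] by (auto simp: frac_at_def intro!: bexI[of _ "h u"])
  next
    fix z assume "z \<in> frac_at S P (h a) (h s)"
    then obtain b' t' u' where *: "z = (b', t')" "b' \<in> carrier S" "t' \<in> carrier S" "t' \<notin> P"
      "u' \<in> carrier S" "u' \<notin> P" "u' \<otimes>\<^bsub>S\<^esub> (h a \<otimes>\<^bsub>S\<^esub> t' \<ominus>\<^bsub>S\<^esub> b' \<otimes>\<^bsub>S\<^esub> h s) = \<zero>\<^bsub>S\<^esub>"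
      by (auto simp: frac_at_def)
    obtain b t u where **: "b \<in> carrier R" "t \<in> carrier R" "u \<in> carrier R" "b' = h b" "t' = h t" "u' = h u"
      using h_surj *(2,3,5) by metis
    then have "(b, t) \<in> frac_at R (contract R h P) a s"
      using * zero[of u t b] by (auto simp: frac_at_def contract_def intro!: bexI[of _ u])
    then show "z \<in> frac_map h (frac_at R (contract R h P) a s)"
      unfolding frac_map_def by (rule rev_image_eqI) (simp add: * **)
  qed
qed

lemma frac_map_in_carrier:
  assumes "C \<in> carrier (localization_at R (contract R h P))"
  shows "frac_map h C \<in> carrier (localization_at S P)"
proof -
  from assms obtain a s where as: "C = frac_at R (contract R h P) a s" "a \<in> carrier R" "s \<in> carrier R"
    "h s \<notin> P" by (auto simp: localization_at_def contract_def)
  have "frac_map h C = frac_at S P (h a) (h s)" unfolding as(1) by (rule frac_map_frac_at[OF as(2,3)])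
  then show ?thesis using as by (auto simp: localization_at_def)
qed

lemma frac_map_UN: "frac_map h (\<Union>x\<in>C. F x) = (\<Union>x\<in>C. frac_map h (F x))"
  by (auto simp: frac_map_def)

text \<open>The operations are unions over all representatives, and images commute with unions, so
  no representatives have to be chosen.\<close>

lemma frac_map_mult:
  assumes "C \<in> carrier (localization_at R (contract R h P))" "D \<in> carrier (localization_at R (contract R h P))"
  shows "frac_map h (C \<otimes>\<^bsub>localization_at R (contract R h P)\<^esub> D)
    = frac_map h C \<otimes>\<^bsub>localization_at S P\<^esub> frac_map h D"
proof -
  note sub = assms[THEN localization_carrier_subset]
  have "frac_map h (C \<otimes>\<^bsub>localization_at R (contract R h P)\<^esub> D) = (\<Union>x\<in>C. \<Union>y\<in>D.
      frac_map h (frac_at R (contract R h P) (fst x \<otimes>\<^bsub>R\<^esub> fst y) (snd x \<otimes>\<^bsub>R\<^esub> snd y)))"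
    by (simp add: localization_at_def frac_map_UN case_prod_beta)
  also have "\<dots> = (\<Union>x\<in>C. \<Union>y\<in>D.
      frac_at S P (h (fst x) \<otimes>\<^bsub>S\<^esub> h (fst y)) (h (snd x) \<otimes>\<^bsub>S\<^esub> h (snd y)))"
    using sub by (intro SUP_cong refl) (subst frac_map_frac_at; force)
  also have "\<dots> = frac_map h C \<otimes>\<^bsub>localization_at S P\<^esub> frac_map h D"
    by (simp add: localization_at_def frac_map_def case_prod_beta)
  finally show ?thesis .
qed

lemma frac_map_add:
  assumes "C \<in> carrier (localization_at R (contract R h P))" "D \<in> carrier (localization_at R (contract R h P))"
  shows "frac_map h (C \<oplus>\<^bsub>localization_at R (contract R h P)\<^esub> D)
    = frac_map h C \<oplus>\<^bsub>localization_at S P\<^esub> frac_map h D"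
proof -
  note sub = assms[THEN localization_carrier_subset]
  have "frac_map h (C \<oplus>\<^bsub>localization_at R (contract R h P)\<^esub> D) = (\<Union>x\<in>C. \<Union>y\<in>D.
      frac_map h (frac_at R (contract R h P)
        (fst x \<otimes>\<^bsub>R\<^esub> snd y \<oplus>\<^bsub>R\<^esub> fst y \<otimes>\<^bsub>R\<^esub> snd x) (snd x \<otimes>\<^bsub>R\<^esub> snd y)))"
    by (simp add: localization_at_def frac_map_UN case_prod_beta)
  also have "\<dots> = (\<Union>x\<in>C. \<Union>y\<in>D. frac_at S P
      (h (fst x) \<otimes>\<^bsub>S\<^esub> h (snd y) \<oplus>\<^bsub>S\<^esub> h (fst y) \<otimes>\<^bsub>S\<^esub> h (snd x)) (h (snd x) \<otimes>\<^bsub>S\<^esub> h (snd y)))"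
    using sub by (intro SUP_cong refl) (subst frac_map_frac_at; force)
  also have "\<dots> = frac_map h C \<oplus>\<^bsub>localization_at S P\<^esub> frac_map h D"
    by (simp add: localization_at_def frac_map_def case_prod_beta)
  finally show ?thesis .
qed

lemma sheaf_map_apply:
  "P \<in> spec_preimage R S h V \<Longrightarrow> sheaf_map R S h V \<xi> P = frac_map h (\<xi> (contract R h P))"
  by (simp add: sheaf_map_def)

lemma section_value:
  "\<xi> \<in> carrier (structure_sheaf R V) \<Longrightarrow> P \<in> spec_preimage R S h V \<Longrightarrow>
    \<xi> (contract R h P) \<in> carrier (localization_at R (contract R h P))"
  by (auto simp: structure_sheaf_def spec_preimage_def)

text \<open>Where a section is the fraction a/s on U, its transport is h a / h s on the preimage of
  U.\<close>

lemma sheaf_map_in_carrier: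
  assumes \<xi>: "\<xi> \<in> carrier (structure_sheaf R V)"
  shows "sheaf_map R S h V \<xi> \<in> carrier (structure_sheaf S (spec_preimage R S h V))"
proof -
  let ?W = "spec_preimage R S h V"
  have "sheaf_map R S h V \<xi> \<in> (\<Pi>\<^sub>E P\<in>?W. carrier (localization_at S P))"
    unfolding sheaf_map_def by (intro restrict_PiE_iff[THEN iffD2] ballI frac_map_in_carrier section_value[OF \<xi>])
  moreover have "\<exists>U. openin (zariski_topology S) U \<and> P \<in> U \<and> U \<subseteq> ?W \<and>
      (\<exists>a\<in>carrier S. \<exists>s\<in>carrier S. \<forall>Q\<in>U. s \<notin> Q \<and> sheaf_map R S h V \<xi> Q = frac_at S Q a s)"
    if P: "P \<in> ?W" for P
  proof -
    have prime: "primeideal P S" and "contract R h P \<in> V" using P by (auto simp: spec_preimage_def)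
    then obtain U a s where U: "openin (zariski_topology R) U" "contract R h P \<in> U" "U \<subseteq> V"
      and as: "a \<in> carrier R" "s \<in> carrier R" "\<forall>Q\<in>U. s \<notin> Q \<and> \<xi> Q = frac_at R Q a s"
      using \<xi> unfolding structure_sheaf_def by simp blast
    have "h s \<notin> Q \<and> sheaf_map R S h V \<xi> Q = frac_at S Q (h a) (h s)"
      if Q: "Q \<in> spec_preimage R S h U" for Q
    proof
      have Q': "contract R h Q \<in> U" "Q \<in> ?W" using Q U(3) by (auto simp: spec_preimage_def)
      show "h s \<notin> Q" using as Q'(1) by (auto simp: contract_def)
      show "sheaf_map R S h V \<xi> Q = frac_at S Q (h a) (h s)"
        using as(3) Q'(1) by (simp add: sheaf_map_apply[OF Q'(2)] frac_map_frac_at[OF as(1,2)])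
    qed
    then show ?thesis
      using openin_spec_preimage[OF U(1)] prime U(2,3) as(1,2)
      by (intro exI[of _ "spec_preimage R S h U"] conjI bexI[of _ "h a"] bexI[of _ "h s"])
        (auto simp: spec_preimage_def)
  qed
  ultimately show ?thesis by (simp add: structure_sheaf_def)
qed

text \<open>By this symmetry every result of the locale also serves for the inverse map.\<close>

lemma cring_iso_inv: "cring_iso S R (inv_into (carrier R) h)"
  by (intro cring_iso.intro cring_R cring_S ring_iso_set_sym[OF R.ring_axioms iso])

lemma inv_h [simp]:
  "a \<in> carrier R \<Longrightarrow> inv_into (carrier R) h (h a) = a"
  "b \<in> carrier S \<Longrightarrow> h (inv_into (carrier R) h b) = b"
  using iso by (auto simp: ring_iso_def bij_betw_def inv_into_f_f f_inv_into_f)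

lemma contract_inv:
  assumes "primeideal Q R"
  shows "contract R h (contract S (inv_into (carrier R) h) Q) = Q"
  using ideal.Icarr[OF primeideal.axioms(1)[OF assms]] by (auto simp: contract_def)

lemma inv_contract:
  assumes "primeideal P S"
  shows "contract S (inv_into (carrier R) h) (contract R h P) = P"
proof -
  interpret inv: cring_iso S R "inv_into (carrier R) h" by (rule cring_iso_inv)
  show ?thesis
    using ideal.Icarr[OF primeideal.axioms(1)[OF assms]] inv.hom_closed by (auto simp: contract_def)
qed

lemma frac_map_inv:
  assumes "C \<in> carrier (localization_at S P)"
  shows "frac_map h (frac_map (inv_into (carrier R) h) C) = C"
proof -
  have "(\<lambda>x. map_prod h h (map_prod (inv_into (carrier R) h) (inv_into (carrier R) h) x)) ` C = (\<lambda>x. x) ` C"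
    using localization_carrier_subset[OF assms] by (intro image_cong) auto
  then show ?thesis by (simp add: frac_map_def image_image)
qed

lemma inv_frac_map:
  assumes "C \<in> carrier (localization_at R P)"
  shows "frac_map (inv_into (carrier R) h) (frac_map h C) = C"
proof -
  have "(\<lambda>x. map_prod (inv_into (carrier R) h) (inv_into (carrier R) h) (map_prod h h x)) ` C = (\<lambda>x. x) ` C"
    using localization_carrier_subset[OF assms] by (intro image_cong) auto
  then show ?thesis by (simp add: frac_map_def image_image)
qed

lemma spec_preimage_inv:
  assumes "V \<subseteq> {Q. primeideal Q R}"
  shows "spec_preimage S R (inv_into (carrier R) h) (spec_preimage R S h V) = V"
proof -
  interpret inv: cring_iso S R "inv_into (carrier R) h" by (rule cring_iso_inv)
  show ?thesis
    using assms inv.primeideal_contract by (auto simp: spec_preimage_def contract_inv)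
qed

lemma homeomorphic_contract:
  "homeomorphic_map (zariski_topology S) (zariski_topology R) (contract R h)"
proof -
  interpret inv: cring_iso S R "inv_into (carrier R) h" by (rule cring_iso_inv)
  have "homeomorphic_maps (zariski_topology S) (zariski_topology R) (contract R h)
      (contract S (inv_into (carrier R) h))"
    unfolding homeomorphic_maps_def
    using continuous_contract inv.continuous_contract
    by (simp add: topspace_zariski contract_inv inv_contract)
  then show ?thesis by (auto simp: homeomorphic_map_maps)
qed

lemma sheaf_map_ring_iso:
  assumes V: "V \<subseteq> {Q. primeideal Q R}"
  shows "sheaf_map R S h V \<in> ring_iso (structure_sheaf R V) (structure_sheaf S (spec_preimage R S h V))"
proof -
  let ?W = "spec_preimage R S h V" and ?i = "inv_into (carrier R) h"
  interpret inv: cring_iso S R ?i by (rule cring_iso_inv)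
  note preimage_V = spec_preimage_inv[OF V]
  have in_V: "contract R h P \<in> V" "primeideal P S" if "P \<in> ?W" for P
    using that by (auto simp: spec_preimage_def)
  \<comment> \<open>Sections are extensional, so outside the open set both sides of an equation of
    sections are the default value.\<close>
  have ext: "\<tau> P = undefined" if "\<tau> \<in> carrier (structure_sheaf T U)" "P \<notin> U"
    for \<tau> T U P using that by (auto simp: structure_sheaf_def PiE_def extensional_def)
  show ?thesis
  proof (rule ring_iso_memI)
    fix \<xi> \<tau> assume \<xi>: "\<xi> \<in> carrier (structure_sheaf R V)"
    then show "sheaf_map R S h V \<xi> \<in> carrier (structure_sheaf S ?W)" by (rule sheaf_map_in_carrier)
    assume \<tau>: "\<tau> \<in> carrier (structure_sheaf R V)"
    show "sheaf_map R S h V (\<xi> \<otimes>\<^bsub>structure_sheaf R V\<^esub> \<tau>)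
        = sheaf_map R S h V \<xi> \<otimes>\<^bsub>structure_sheaf S ?W\<^esub> sheaf_map R S h V \<tau>"
      unfolding sheaf_map_def structure_sheaf_def ring_record_simps
      by (intro restrict_ext) (simp add: in_V(1) frac_map_mult section_value[OF \<xi>] section_value[OF \<tau>])
    show "sheaf_map R S h V (\<xi> \<oplus>\<^bsub>structure_sheaf R V\<^esub> \<tau>)
        = sheaf_map R S h V \<xi> \<oplus>\<^bsub>structure_sheaf S ?W\<^esub> sheaf_map R S h V \<tau>"
      unfolding sheaf_map_def structure_sheaf_def ring_record_simps
      by (intro restrict_ext) (simp add: in_V(1) frac_map_add section_value[OF \<xi>] section_value[OF \<tau>])
  next
    have "frac_map h \<one>\<^bsub>localization_at R (contract R h P)\<^esub> = \<one>\<^bsub>localization_at S P\<^esub>" for P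
      using frac_map_frac_at[of "\<one>\<^bsub>R\<^esub>" "\<one>\<^bsub>R\<^esub>" P] by (simp add: localization_at_def)
    then show "sheaf_map R S h V \<one>\<^bsub>structure_sheaf R V\<^esub> = \<one>\<^bsub>structure_sheaf S ?W\<^esub>"
      unfolding sheaf_map_def structure_sheaf_def ring_record_simps
      by (intro restrict_ext) (simp add: in_V(1))
  next
    \<comment> \<open>The inverse is the sheaf map of the inverse ring isomorphism, and
      \<open>preimage_V\<close> identifies its target with the sections over V.\<close>
    show "bij_betw (sheaf_map R S h V) (carrier (structure_sheaf R V)) (carrier (structure_sheaf S ?W))"
    proof (rule bij_betwI[where g = "sheaf_map S R ?i ?W"])
      show "sheaf_map R S h V \<in> carrier (structure_sheaf R V) \<rightarrow> carrier (structure_sheaf S ?W)"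
        by (auto intro: sheaf_map_in_carrier)
      show "sheaf_map S R ?i ?W \<in> carrier (structure_sheaf S ?W) \<rightarrow> carrier (structure_sheaf R V)"
        using inv.sheaf_map_in_carrier[of _ ?W] unfolding preimage_V by auto
      fix \<xi> assume \<xi>: "\<xi> \<in> carrier (structure_sheaf R V)"
      show "sheaf_map S R ?i ?W (sheaf_map R S h V \<xi>) = \<xi>"
      proof
        fix Q show "sheaf_map S R ?i ?W (sheaf_map R S h V \<xi>) Q = \<xi> Q"
        proof (cases "Q \<in> V")
          case True
          then have Q: "primeideal Q R" using V by auto
          have W: "contract S ?i Q \<in> ?W"
            using True inv.primeideal_contract[OF Q] by (simp add: spec_preimage_def contract_inv[OF Q])
          have "sheaf_map S R ?i ?W (sheaf_map R S h V \<xi>) Q = frac_map ?i (frac_map h (\<xi> Q))"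
            using True preimage_V by (subst inv.sheaf_map_apply) (auto simp: sheaf_map_apply[OF W] contract_inv[OF Q])
          also have "\<dots> = \<xi> Q"
            using section_value[OF \<xi> W] by (simp add: contract_inv[OF Q] inv_frac_map)
          finally show ?thesis .
        next
          case False
          then show ?thesis using ext[OF \<xi>] by (simp add: sheaf_map_def preimage_V)
        qed
      qed
    next
      fix \<tau> assume \<tau>: "\<tau> \<in> carrier (structure_sheaf S ?W)"
      show "sheaf_map R S h V (sheaf_map S R ?i ?W \<tau>) = \<tau>"
      proof
        fix P show "sheaf_map R S h V (sheaf_map S R ?i ?W \<tau>) P = \<tau> P"
        proof (cases "P \<in> ?W")
          case True
          note P = in_V[OF True]
          have W: "contract R h P \<in> spec_preimage S R ?i ?W" using P(1) preimage_V by simp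
          have "sheaf_map R S h V (sheaf_map S R ?i ?W \<tau>) P = frac_map h (frac_map ?i (\<tau> P))"
            by (simp add: sheaf_map_apply[OF True] inv.sheaf_map_apply[OF W] inv_contract[OF P(2)])
          also have "\<dots> = \<tau> P"
            using inv.section_value[OF \<tau> W] by (simp add: inv_contract[OF P(2)] frac_map_inv)
          finally show ?thesis .
        next
          case False
          then show ?thesis using ext[OF \<tau>] by (simp add: sheaf_map_def)
        qed
      qed
    qed
  qed
qed

lemma isomorphic_over_Spec:
  assumes "\<And>c. \<iota> c \<in> carrier R" "\<And>c. h (\<iota> c) = \<kappa> c"
  shows "isomorphic_over (Spec S \<kappa>) (Spec R \<iota>)"
  unfolding isomorphic_over_def
proof (intro exI conjI)
  show "homeomorphic_map (points (Spec S \<kappa>)) (points (Spec R \<iota>)) (contract R h)"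
    using homeomorphic_contract by (simp add: Spec_def)
  define pre where "pre = (\<lambda>V. {P \<in> topspace (points (Spec S \<kappa>)). contract R h P \<in> V})"
  have pre: "pre V = spec_preimage R S h V" for V
    by (simp add: pre_def Spec_def topspace_zariski spec_preimage_def)
  have primes: "V \<subseteq> {Q. primeideal Q R}" if "openin (points (Spec R \<iota>)) V" for V
    using openin_subset[OF that] by (simp add: Spec_def topspace_zariski)
  have "sheaf_map R S h V \<in> algebra_iso (sections (Spec R \<iota>) V) (scalar (Spec R \<iota>) V)
      (sections (Spec S \<kappa>) (pre V)) (scalar (Spec S \<kappa>) (pre V))"
    if "openin (points (Spec R \<iota>)) V" for V
  proof -
    have "sheaf_map R S h V (\<lambda>P\<in>V. frac_at R P (\<iota> c) \<one>\<^bsub>R\<^esub>) = (\<lambda>P\<in>pre V. frac_at S P (\<kappa> c) \<one>\<^bsub>S\<^esub>)" for c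
      unfolding sheaf_map_def pre
      by (intro restrict_ext) (auto simp: spec_preimage_def frac_map_frac_at assms)
    then show ?thesis
      using sheaf_map_ring_iso[OF primes[OF that]] by (simp add: algebra_iso_def Spec_def pre)
  qed
  moreover have "sheaf_map R S h W (restriction (Spec R \<iota>) V W \<xi>)
      = restriction (Spec S \<kappa>) (pre V) (pre W) (sheaf_map R S h V \<xi>)" if "W \<subseteq> V" for V W \<xi>
    using that by (auto simp: Spec_def pre sheaf_map_def spec_preimage_def restrict_def fun_eq_iff)
  ultimately show "let pre = \<lambda>V. {P \<in> topspace (points (Spec S \<kappa>)). contract R h P \<in> V} in
      (\<forall>V. openin (points (Spec R \<iota>)) V \<longrightarrow>
        sheaf_map R S h V \<in> algebra_iso (sections (Spec R \<iota>) V) (scalar (Spec R \<iota>) V)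
          (sections (Spec S \<kappa>) (pre V)) (scalar (Spec S \<kappa>) (pre V))) \<and>
      (\<forall>V W. openin (points (Spec R \<iota>)) V \<and> openin (points (Spec R \<iota>)) W \<and> W \<subseteq> V \<longrightarrow>
        (\<forall>\<xi>\<in>carrier (sections (Spec R \<iota>) V).
          sheaf_map R S h W (restriction (Spec R \<iota>) V W \<xi>) =
          restriction (Spec S \<kappa>) (pre V) (pre W) (sheaf_map R S h V \<xi>)))"
    unfolding Let_def pre_def[symmetric] by (intro conjI allI impI ballI) auto
qed

end

context finite_subfield_alg_closed
begin

text \<open>The ring axioms are transported from the polynomial ring along the isomorphism. The
  transported zero is the image of 0, which must first be identified with the zero of the
  quotient.\<close>

lemma cring_A'_invariants:
  assumes "n \<ge> 1"
  shows "cring (A'_invariants q n :: 'k mpol set ring)"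
proof -
  let ?h = "\<lambda>f. A'_class q n (poly_subst (\<lambda>i. dickson q n (Suc i)) f) :: 'k mpol set"
  have zero: "?h \<zero>\<^bsub>mpoly_ring (n - 1)\<^esub> = \<zero>\<^bsub>A'_invariants q n\<^esub>"
  proof -
    have "A'_class q n (0 :: 'k mpol) = A'_ideal q n"
      by (auto simp: A'_class_eq subring_carrier(2) mem_A'_ideal)
    then show ?thesis
      by (simp add: poly_subst_def A'_invariants_def invariants_def A'_def FactRing_def)
  qed
  have "?h \<in> ring_iso (mpoly_ring (n - 1)) (A'_invariants q n)"
    using A'_invariants_iso[OF assms] by (simp add: algebra_iso_def)
  from cring.ring_iso_imp_img_cring[OF cring_mpoly_ring this]
  show ?thesis unfolding zero by simp
qed

end

theorem theorem2p5:
  fixes q s n :: nat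
  assumes "s \<ge> 1" and "q = CARD('p::prime_card) ^ s" and "n \<ge> 1"
  shows "(\<lambda>f. A'_class q n (poly_subst (\<lambda>i. dickson q n (Suc i)) f))
        \<in> algebra_iso (mpoly_ring (n - 1)) Const
            (A'_invariants q n) (A'_const q n :: 'p mod_ring alg_closure \<Rightarrow> _)
    \<and> isomorphic_over
        (Spec_quotient (A' q n) (A'_const q n :: 'p mod_ring alg_closure \<Rightarrow> _)
          (GL q n) (A'_act n))
        (affine_space (n - 1))"
proof -
  \<comment> \<open>The concrete field enters here, with \<open>card_Fq\<close> supplying the size
    of its subfield.\<close>
  interpret finite_subfield_alg_closed q "CARD('p)" s "TYPE('p mod_ring alg_closure)"
    using assms(1,2) prime_card[where 'a = 'p] card_Fq[OF assms(1), where 'p = 'p]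
    by unfold_locales auto
  let ?h = "\<lambda>f :: 'p mod_ring alg_closure mpol.
    A'_class q n (poly_subst (\<lambda>i. dickson q n (Suc i)) f)"
  have h: "?h \<in> algebra_iso (mpoly_ring (n - 1)) Const (A'_invariants q n) (A'_const q n)"
    by (rule A'_invariants_iso[OF assms(3)])
  interpret cring_iso "mpoly_ring (n - 1)" "A'_invariants q n" ?h
    using h by (intro cring_iso.intro cring_mpoly_ring cring_A'_invariants[OF assms(3)])
      (simp add: algebra_iso_def)
  have "isomorphic_over (Spec (A'_invariants q n) (A'_const q n :: 'p mod_ring alg_closure \<Rightarrow> _))
      (Spec (mpoly_ring (n - 1)) Const)"
    using h by (intro isomorphic_over_Spec Const_in_carrier) (simp add: algebra_iso_def)
  with h show ?thesis by (simp add: Spec_quotient_def affine_space_def A'_invariants_def)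
qed

end
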